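(* Let $p\ge 2$ and $m\in\mathbb{Z}_{\ge0}$. Let $\mathbf{c}=(c_1,\dots,c_{p+1})\in(\mathbb{C}\setminus\mathbb{Z})^{p+1}$ and $\mathbf{d}=(d_1,\dots,d_{p-1})\in(\mathbb{C}\setminus\mathbb{Z})^{p-1}$ with $\Re\big(\sum_{j=1}^{p-1}d_j-\sum_{j=1}^{p+1}c_j\big)>-m-1$, and assume the parameters are generic (pairwise differences among the $c_j$, among the $d_j$, and the differences $d_j-c_1$ are non-integers), so that all terms below are finite. Then \begin{multline*} \sum_{k=0}^{\infty}\frac{(\mathbf{c})_{k}}{(\mathbf{d})_{k}(m+k)!\,k!}\Big\{\sum_{d\in\mathbf{d}}\psi(d+k)+\psi(k+1)+\psi(1+m+k)-\sum_{c\in\mathbf{c}}\psi(c+k)\Big\}\\ =\frac{\pi}{m!}\Big[\sum_{c\in\mathbf{c}_{[1]}}\cot(\pi c)-\sum_{d\in\mathbf{d}_{[1]}}\cot(\pi d)\Big]{}_{p+1}F_p\!\left(\begin{matrix}\mathbf{c}\\1+m,\mathbf{d}\end{matrix}\right) +\frac{(1-\mathbf{d})_{1}}{(1-\mathbf{c})_{1}(m-1)!}{}_{p+2}F_{p+1}\!\left(\begin{matrix}1-m,2-\mathbf{d},1,1\\2-\mathbf{c}\end{matrix}\right)\\ +\frac{\Gamma(c_1)\Gamma(d_1)\Gamma(1-\mathbf{c}_{[1]})\Gamma(1-\mathbf{d}_{[1]}+c_1)}{(1-c_1)_m\Gamma(d_1-c_1)\Gamma(1-\mathbf{c}_{[1]}+c_1)\Gamma(1-\mathbf{d}_{[1]})}\,{}_{p+1}F_p\!\left(\begin{matrix}c_1,\,c_1-m,\,1-\mathbf{d}+c_1\\1-\mathbf{c}_{[1]}+c_1\end{matrix}\right)\\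 -\frac{(-1)^m\Gamma(1-\mathbf{c})\sin(\pi c_1)}{\Gamma(1-\mathbf{d})\sin(\pi d_1)}\sum_{k=2}^{p-1}\frac{\Gamma(d_k-m)\Gamma(d_k)\Gamma(d_k-\mathbf{d}_{[k]})\sin(\pi(d_k-d_1))}{(d_k-m-1)(d_k-1)\Gamma(d_k-\mathbf{c})\sin(\pi(d_k-c_1))}\,{}_{p+1}F_p\!\left(\begin{matrix}1+\mathbf{c}-d_k\\2-d_k,\,2-d_k+m,\,1+\mathbf{d}_{[k]}-d_k\end{matrix}\right). \end{multline*}
   Context: $\psi=\Gamma'/\Gamma$ is the digamma function and $(x)_k=\Gamma(x+k)/\Gamma(x)$ the Pochhammer symbol. For a vector $\mathbf{a}=(a_1,\dots,a_q)$ and scalar $\beta$: $\Gamma(\mathbf{a})=\prod_i\Gamma(a_i)$, $(\mathbf{a})_k=\prod_i(a_i)_k$, $\mathbf{a}+\beta=(a_1+\beta,\dots,a_q+\beta)$, $\beta-\mathbf{a}=(\beta-a_1,\dots,\beta-a_q)$, $\mathbf{a}_{[k]}$ is $\mathbf{a}$ with the $k$-th component removed, and $\sum_{a\in\mathbf{a}}$ runs over the components of $\mathbf{a}$. ${}_pF_q(\mathbf{a};\mathbf{b};z)=\sum_{k\ge0}\frac{(\mathbf{a})_k}{(\mathbf{b})_k}\frac{z^k}{k!}$; when the argument is omitted it is $z=1$. Listing several vectors/scalars separated by commas in a parameter row means concatenation. The term $\frac{1}{(m-1)!}{}_{p+2}F_{p+1}(1-m,2-\mathbf{d},1,1;2-\mathbf{c};1)$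 is understood as the finite sum $\sum_{j=0}^{m-1}\frac{(-1)^j(2-\mathbf{d})_j\, j!}{(2-\mathbf{c})_j\,(m-1-j)!}$, which is $0$ for $m=0$. *)

theory Defs
  imports "HOL-Analysis.Analysis"
begin

text \<open>Parameter vectors are represented as lists of complex numbers;
  the first list element is the component with index 1.\<close>

definition poch_vec :: "complex list \<Rightarrow> nat \<Rightarrow> complex" where
  "poch_vec as k = prod_list (map (\<lambda>a. pochhammer a k) as)"

definition Gamma_vec :: "complex list \<Rightarrow> complex" where
  "Gamma_vec as = prod_list (map Gamma as)"

definition hypF :: "complex list \<Rightarrow> complex list \<Rightarrow> complex \<Rightarrow> complex" where
  "hypF as bs z = (\<Sum>k. poch_vec as k / poch_vec bs k * z ^ k / of_nat (fact k))"

definition drop_nth :: "nat \<Rightarrow> 'a list \<Rightarrow> 'a list" where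
  "drop_nth i xs = take i xs @ drop (Suc i) xs"

end

(* Write g(s) = prod_j Gamma(c_j+s) / (prod_k Gamma(d_k+s) * Gamma(1+m+s) Gamma(1+s)).  The left-hand
   side is, up to a factor, the sum of g'(k) over k >= 0.  Multiply g by the 1-periodic function
     prod_{j>=2} sin pi(c_j+s) / (sin^2(pi s) * prod_{k>=2} sin pi(d_k+s)),
   which removes the poles of g at -c_j-n for j >= 2 and is bounded away from its own poles.  The
   product decays like |s|^(-1-sigma), where sigma > 0 is the parametric excess, so its integral over
   large rectangles tends to 0 and the sum of all residues vanishes.  The double poles at 0, 1, 2, ...
   give the left-hand side and the cotangent term, the simple poles at -m, ..., -1 the finite sum, the
   poles at -c_1-n the third term and the poles at 1-d_k+n (k >= 2) the last one. *)
theory Submission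
  imports Defs "HOL-Complex_Analysis.Complex_Analysis"
begin

text \<open>The periodic factor has as many sines above as below, since c has two entries more than
  d; so it stays bounded as |Im s| grows, and only a power of |s| is left to estimate. The Gamma
  asymptotics must hold uniformly in a closed half-plane: they are derived for quotients only, from
  the functional equation, and the left half-plane is brought back to the right one by reflection.
  The vertical sides of all rectangles have real part in one class modulo 1 that misses the poles,
  so a single lower bound for the sines serves every rectangle. At a double pole the residue is a
  derivative containing psi(1 - c_j - k) and psi(1 - d_j - k) for j >= 2; reflecting psi turns these
  into psi(c_j + k), psi(d_j + k) and cotangents. Convergence of the left-hand series is an outcome:
  the residue identity is solved for its partial sums, once the other residue series are known to
  converge absolutely.\<close>

section \<open>Growth of Gamma quotients and of quotients of sines\<close>

text \<open>\<open>Gamma_series'\<close> is the Gauss product, whose factorials cancel in the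
  quotient for \<open>w\<close> and \<open>z\<close>. What remains is a ratio of Pochhammer symbols
  times a power of N, and replacing N by s + N in that power costs only the factor exp((b - a) Ln(1
  + s/N)), which tends to 1.\<close>

lemma Gamma_ratio_shift_tendsto:
  fixes s a b :: complex
  assumes "s + a \<notin> \<int>\<^sub>\<le>\<^sub>0" "s + b \<notin> \<int>\<^sub>\<le>\<^sub>0"
  shows "(\<lambda>N. Gamma (s + of_nat N + a) * rGamma (s + of_nat N + b)
            * exp ((b - a) * Ln (s + of_nat N))) \<longlonglongrightarrow> 1"
proof -
  define z w where "z = s + a" and "w = s + b"
  have z: "z \<notin> \<int>\<^sub>\<le>\<^sub>0" and w: "w \<notin> \<int>\<^sub>\<le>\<^sub>0"
    using assms by (simp_all add: z_def w_def)
  have s0: "(\<lambda>N. s / of_nat N) \<longlonglongrightarrow> 0"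
    by (rule tendsto_divide_0[OF tendsto_const tendsto_of_nat])
  have "Gamma z \<noteq> 0" using z by (simp add: Gamma_eq_zero_iff)
  then have "(\<lambda>N. Gamma z * rGamma w * (Gamma_series' w N / Gamma_series' z N)
            * exp ((b - a) * Ln (1 + s / of_nat N)))
         \<longlonglongrightarrow> Gamma z * rGamma w * (Gamma w / Gamma z) * exp ((b - a) * Ln (1 + 0))"
    by (intro tendsto_mult tendsto_divide tendsto_const tendsto_exp tendsto_Ln tendsto_add s0
        Gamma_series'_LIMSEQ) auto
  also have "Gamma z * rGamma w * (Gamma w / Gamma z) * exp ((b - a) * Ln (1 + 0)) = 1"
    using z w by (simp add: rGamma_inverse_Gamma Gamma_eq_zero_iff)
  finally have lim: "(\<lambda>N. Gamma z * rGamma w * (Gamma_series' w N / Gamma_series' z N)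
            * exp ((b - a) * Ln (1 + s / of_nat N))) \<longlonglongrightarrow> 1" .
  have "eventually (\<lambda>N. Gamma z * rGamma w * (Gamma_series' w N / Gamma_series' z N)
            * exp ((b - a) * Ln (1 + s / of_nat N))
          = Gamma (s + of_nat N + a) * rGamma (s + of_nat N + b)
            * exp ((b - a) * Ln (s + of_nat N))) sequentially"
  proof -
    have "eventually (\<lambda>N. real N > norm s) sequentially"
      by real_asymp
    then show ?thesis using eventually_gt_at_top[of 0]
    proof eventually_elim
      case (elim N)
      have ne: "1 + s / of_nat N \<noteq> 0"
      proof
        assume "1 + s / of_nat N = 0"
        then have "s = - of_nat N" using elim
          by (simp add: field_simps add_eq_0_iff)
        then have "norm s = real N" by simp
        then show False using elim by simp
      qed
      have eqs: "s + of_nat N = of_real (real N) * (1 + s / of_nat N)"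
        using elim by (simp add: field_simps)
      have Ln: "Ln (s + of_nat N) = of_real (ln (real N)) + Ln (1 + s / of_nat N)"
        using elim ne unfolding eqs by (subst Ln_times_of_real) auto
      have pz: "Gamma (s + of_nat N + a) = Gamma z * pochhammer z N"
        using pochhammer_Gamma[OF z, of N] z by (simp add: z_def add_ac Gamma_eq_zero_iff)
      have pw: "rGamma w = pochhammer w N * rGamma (s + of_nat N + b)"
        using pochhammer_rGamma[of w N] by (simp add: w_def add_ac)
      have pz0: "pochhammer z N \<noteq> 0" and pw0: "pochhammer w N \<noteq> 0"
        using z w by (auto dest: pochhammer_eq_0_imp_nonpos_Int)
      have ef: "exp ((b - a) * Ln (s + of_nat N)) =
              exp (w * of_real (ln (real N))) / exp (z * of_real (ln (real N)))
               * exp ((b - a) * Ln (1 + s / of_nat N))"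
        unfolding Ln exp_diff[symmetric] exp_add[symmetric]
        by (simp add: algebra_simps z_def w_def)
      show ?case
        unfolding ef pz pw Gamma_series'_def using pz0 pw0
        by (simp add: field_simps)
    qed
  qed
  from Lim_transform_eventually[OF lim this] show ?thesis .
qed

text \<open>Both s and 1 + 1/s have argument at most pi/2 in modulus, the second one strictly, so
  the sum of the arguments does not reach the branch cut.\<close>

lemma Ln_plus_1_eq:
  assumes "Re s \<ge> 0" "s \<noteq> 0"
  shows "Ln (s + 1) = Ln s + Ln (1 + 1 / s)"
proof -
  have re: "Re (1 + 1 / s) > 0"
    using assms by (simp add: Re_divide add_pos_nonneg)
  then have ne: "1 + 1 / s \<noteq> 0" by (metis less_irrefl zero_complex.simps(1))
  have "\<bar>Im (Ln (1 + 1/s))\<bar> < pi/2"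
    using Re_Ln_pos_lt[OF ne] re by simp
  moreover have "\<bar>Im (Ln s)\<bar> \<le> pi/2"
    using Re_Ln_pos_le[OF assms(2)] assms by simp
  ultimately have "Ln (s * (1 + 1/s)) = Ln s + Ln (1 + 1/s)"
    using assms ne by (intro Ln_times_simple) auto
  moreover have "s * (1 + 1/s) = s + 1" using assms by (simp add: field_simps)
  ultimately show ?thesis by simp
qed

lemma sum_inverse_squares_le:
  "(\<Sum>n<N. 1 / (1 + real n ^ 2)) \<le> pi\<^sup>2 / 3"
proof -
  have "(\<Sum>n<N. 1 / (1 + real n ^ 2)) \<le> (\<Sum>n<N. 2 * (1 / (real n + 1)\<^sup>2))"
  proof (rule sum_mono)
    fix n
    have "(real n + 1)\<^sup>2 \<le> 2 * (1 + real n ^ 2)"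
      using sum_squares_bound[of "real n" 1] by (simp add: power2_eq_square algebra_simps)
    then show "1 / (1 + real n ^ 2) \<le> 2 * (1 / (real n + 1)\<^sup>2)"
      by (simp add: divide_simps add_nonneg_eq_0_iff not_less[symmetric] add_pos_nonneg)
  qed
  also have "\<dots> = 2 * (\<Sum>n<N. 1 / (real n + 1)\<^sup>2)" by (simp add: sum_distrib_left)
  also have "(\<Sum>n<N. 1 / (real n + 1)\<^sup>2) \<le> pi\<^sup>2/6"
    using inverse_squares_sums sum_le_suminf[of "\<lambda>n. 1 / (real n + 1)\<^sup>2" "{..<N}"]
    by (auto simp: sums_iff add_ac)
  finally show ?thesis by simp
qed

text \<open>Stirling's estimate for quotients, uniform in the closed right half-plane. There |s +
  N|^2 is at least |s|^2 + N^2, so the errors made at the shifted points add up to a bound that does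
  not depend on s.\<close>

lemma norm_Gamma_ratio_le:
  fixes a b :: complex
  shows "\<exists>C R. C > 0 \<and> R \<ge> 1 \<and> (\<forall>s. Re s \<ge> 0 \<longrightarrow> norm s \<ge> R \<longrightarrow>
           norm (Gamma (s + a) * rGamma (s + b)) \<le> C * norm s powr Re (a - b))"
proof -
  \<comment> \<open>For |s| >= R the quotients a/s, b/s and 1/s have modulus at most 1/2, as the
    linear estimate of Ln requires; if also Re s >= 0, then s + a and s + b miss the poles of
    Gamma.\<close>
  define R where "R = 2 + 2 * norm a + 2 * norm b"
  define \<delta> where "\<delta> = b - a"
  txt \<open>The quotient \<open>Q s / Q (s + 1)\<close> is \<open>exp (L s)\<close> with \<open>L s = O(1/s\<^sup>2)\<close>, and \<open>Q (s + N) \<longlonglongrightarrow> 1\<close>;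
    telescoping therefore bounds \<open>Q\<close>.\<close>
  define Q where "Q = (\<lambda>s. Gamma (s + a) * rGamma (s + b) * exp (\<delta> * Ln s))"
  define L where "L = (\<lambda>s. Ln (1 + b / s) - Ln (1 + a / s) - \<delta> * Ln (1 + 1 / s))"
  define C0 where "C0 = 2 * norm b ^ 2 + 2 * norm a ^ 2 + 2 * norm \<delta>"
  have C0: "C0 \<ge> 0" by (simp add: C0_def)
  have R2: "R \<ge> 2" by (simp add: R_def)
  have nonpole: "s + x \<notin> \<int>\<^sub>\<le>\<^sub>0" if "Re s \<ge> 0" "norm s \<ge> R" "x \<in> {a, b}" for s x
  proof
    assume "s + x \<in> \<int>\<^sub>\<le>\<^sub>0"
    then obtain n where n: "s + x = - of_nat n" by (elim nonpos_Ints_cases')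
    then have "Re s + Re x = - real n" by (metis Re_complex_of_real minus_complex.simps(1) of_real_minus of_real_of_nat_eq plus_complex.simps(1))
    then have "real n \<le> norm x" using that abs_Re_le_cmod[of x] by linarith
    moreover have "norm s \<le> real n + norm x"
      using n norm_triangle_ineq4[of "- of_nat n" x]
      by (metis add_diff_cancel_right' norm_minus_cancel norm_of_nat)
    ultimately have "norm s \<le> 2 * norm x" by simp
    moreover have "2 * norm x < R" using that norm_ge_zero[of a] norm_ge_zero[of b]
      unfolding R_def by (elim insertE emptyE; simp; linarith)
    ultimately show False using that by simp
  qed
  have L_bound: "norm (L s) \<le> C0 / norm s ^ 2" if "norm s \<ge> R" for s
  proof -
    have s0: "norm s > 0" using that R2 by linarith
    have *: "norm (Ln (1 + x / s) - x / s) \<le> 2 * norm x ^ 2 / norm s ^ 2" if "norm x * 2 \<le> R" for x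
    proof -
      have le: "norm (x / s) \<le> 1/2" using that \<open>norm s \<ge> R\<close> s0
        by (simp add: norm_divide divide_simps)
      have "norm (Ln (1 + x / s) - x / s) \<le> norm (x/s) ^ 2 / (1 - norm (x/s))"
        by (rule Ln_approx_linear) (use le in linarith)
      also have "\<dots> \<le> norm (x/s) ^ 2 / (1/2)"
        using le by (intro divide_left_mono) auto
      finally show ?thesis by (simp add: norm_divide power_divide mult.commute)
    qed
    \<comment> \<open>The terms of order 1/s cancel because \<delta> = b - a; this makes the error
      summable along s + N.\<close>
    have "L s = (Ln (1 + b / s) - b / s) - (Ln (1 + a / s) - a / s) - \<delta> * (Ln (1 + 1 / s) - 1 / s)"
      using s0 by (auto simp: L_def \<delta>_def field_simps)
    also have "norm \<dots> \<le> norm (Ln (1 + b / s) - b / s) + norm (Ln (1 + a / s) - a / s)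
         + norm \<delta> * norm (Ln (1 + 1 / s) - 1 / s)"
      by (metis (no_types, lifting) add_mono_thms_linordered_semiring(3) norm_mult norm_triangle_ineq4 order_trans)
    also have "\<dots> \<le> 2 * norm b ^ 2 / norm s ^ 2 + 2 * norm a ^ 2 / norm s ^ 2
                 + norm \<delta> * (2 * norm (1::complex) ^ 2 / norm s ^ 2)"
      by (intro add_mono mult_left_mono *) (auto simp: R_def)
    also have "\<dots> = C0 / norm s ^ 2" by (simp add: C0_def add_divide_distrib)
    finally show ?thesis .
  qed
  have step: "Q s = Q (s + 1) * exp (L s)" if s: "Re s \<ge> 0" "norm s \<ge> R" for s
  proof -
    have s0: "s \<noteq> 0" using s R2 by auto
    have na: "s + a \<notin> \<int>\<^sub>\<le>\<^sub>0" and nb: "s + b \<notin> \<int>\<^sub>\<le>\<^sub>0" using nonpole s by auto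
    have a0: "s + a \<noteq> 0" and b0: "s + b \<noteq> 0" using na nb by auto
    have ea: "exp (Ln (1 + a / s)) = (s + a) / s" and eb: "exp (Ln (1 + b / s)) = (s + b) / s"
      using a0 b0 s0 by (subst exp_Ln; simp add: field_simps)+
    have L1: "Ln (s + 1) = Ln s + Ln (1 + 1 / s)" using s s0 by (intro Ln_plus_1_eq) auto
    have Ga: "Gamma (s + 1 + a) = (s + a) * Gamma (s + a)"
      using Gamma_plus1[OF na] by (simp add: add_ac)
    have Gb: "rGamma (s + b) = (s + b) * rGamma (s + 1 + b)"
      using rGamma_plus1[of "s + b"] by (simp add: add_ac)
    show ?thesis
    proof -
      have "(s + b) / s / ((s + a) / s) = (s + b) / (s + a)" using s0 by simp
      then show ?thesis
        unfolding Q_def L_def L1 Ga Gb exp_diff ea eb distrib_left exp_add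
        using a0 by simp
    qed
  qed
  have iter: "norm (Q s) \<le> norm (Q (s + of_nat N)) * exp (C0 * (\<Sum>n<N. 1 / (1 + real n ^ 2)))"
    if s: "Re s \<ge> 0" "norm s \<ge> R" for s N
  proof (induction N)
    case (Suc N)
    have n2: "norm (s + of_nat N) ^ 2 \<ge> norm s ^ 2 + real N ^ 2"
      using s by (simp add: cmod_power2 power2_sum)
    have "norm s ^ 2 \<ge> R ^ 2" using s R2 by (intro power_mono) auto
    moreover have "R ^ 2 \<ge> 1" using R2 by (simp add: power2_eq_square mult_mono'[of 1 R 1 R, simplified])
    ultimately have n3: "norm (s + of_nat N) ^ 2 \<ge> 1 + real N ^ 2" using n2 by linarith
    have "norm (s + of_nat N) ^ 2 \<ge> norm s ^ 2" using n2 by (smt (verit) zero_le_power2)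
    then have nR: "norm (s + of_nat N) \<ge> R" using s
      by (smt (verit) norm_ge_zero power2_le_imp_le)
    have "norm (Q (s + of_nat N)) = norm (Q (s + of_nat (Suc N))) * norm (exp (L (s + of_nat N)))"
      using step[of "s + of_nat N"] s nR by (simp add: norm_mult add_ac)
    also have "norm (exp (L (s + of_nat N))) \<le> exp (norm (L (s + of_nat N)))"
      by (rule norm_exp)
    also have "norm (L (s + of_nat N)) \<le> C0 / norm (s + of_nat N) ^ 2"
      by (rule L_bound[OF nR])
    also have "\<dots> \<le> C0 / (1 + real N ^ 2)"
    proof -
      have "1 + real N ^ 2 > 0" by (simp add: add_pos_nonneg)
      then show ?thesis using n3 C0 by (intro divide_left_mono mult_pos_pos) linarith+
    qed
    finally have "norm (Q (s + of_nat N)) \<le> norm (Q (s + of_nat (Suc N))) * exp (C0 / (1 + real N ^ 2))"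
      by (simp add: mult_left_mono)
    with Suc have "norm (Q s) \<le> (norm (Q (s + of_nat (Suc N))) * exp (C0 / (1 + real N ^ 2)))
        * exp (C0 * (\<Sum>n<N. 1 / (1 + real n ^ 2)))"
      by (meson exp_ge_zero mult_right_mono order_trans)
    also have "\<dots> = norm (Q (s + of_nat (Suc N))) * exp (C0 * (\<Sum>n<Suc N. 1 / (1 + real n ^ 2)))"
      by (simp add: distrib_left exp_add)
    finally show ?case .
  qed simp
  define K where "K = exp (C0 * (pi\<^sup>2 / 3))"
  have Q_bound: "norm (Q s) \<le> K" if s: "Re s \<ge> 0" "norm s \<ge> R" for s
  proof (rule LIMSEQ_le_const)
    have "(\<lambda>N. norm (Q (s + of_nat N)) * K) \<longlonglongrightarrow> norm (1::complex) * K"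
      unfolding Q_def \<delta>_def
      using Gamma_ratio_shift_tendsto[of s a b] nonpole s
      by (intro tendsto_intros) auto
    then show "(\<lambda>N. norm (Q (s + of_nat N)) * K) \<longlonglongrightarrow> K" by simp
    have "norm (Q s) \<le> norm (Q (s + of_nat N)) * K" for N
    proof -
      have "exp (C0 * (\<Sum>n<N. 1 / (1 + real n ^ 2))) \<le> K"
        unfolding K_def exp_le_cancel_iff by (intro mult_left_mono sum_inverse_squares_le C0)
      then show ?thesis using iter[OF s, of N]
        by (meson mult_left_mono norm_ge_zero order_trans)
    qed
    then show "\<exists>N. \<forall>n\<ge>N. norm (Q s) \<le> norm (Q (s + of_nat n)) * K" by blast
  qed
  show ?thesis
  proof (intro exI conjI allI impI)
    show "K * exp (\<bar>Im \<delta>\<bar> * pi) > 0" by (simp add: K_def)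
    show "R \<ge> 1" using R2 by simp
    fix s assume s: "Re s \<ge> 0" "norm s \<ge> R"
    have s0: "s \<noteq> 0" using s R2 by auto
    have "norm (Gamma (s + a) * rGamma (s + b)) = norm (Q s) * norm (exp (- (\<delta> * Ln s)))"
      unfolding Q_def by (simp add: norm_mult exp_minus norm_inverse)
    also have "norm (exp (- (\<delta> * Ln s))) = exp (- Re \<delta> * ln (norm s) + Im \<delta> * Im (Ln s))"
      using s0 by simp
    also have "\<dots> = norm s powr Re (a - b) * exp (Im \<delta> * Im (Ln s))"
      using s0 by (simp add: exp_add powr_def \<delta>_def)
    \<comment> \<open>A complex power also depends on the argument of s; since that is at most pi in
      modulus, only the constant changes.\<close>
    also have "exp (Im \<delta> * Im (Ln s)) \<le> exp (\<bar>Im \<delta>\<bar> * pi)"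
    proof -
      have "\<bar>Im (Ln s)\<bar> \<le> pi" using Im_Ln_le_pi[OF s0] mpi_less_Im_Ln[OF s0] by auto
      then have "\<bar>Im \<delta> * Im (Ln s)\<bar> \<le> \<bar>Im \<delta>\<bar> * pi"
        by (simp add: abs_mult mult_left_mono)
      then show ?thesis by simp
    qed
    finally have "norm (Gamma (s + a) * rGamma (s + b)) \<le>
        norm (Q s) * (norm s powr Re (a - b) * exp (\<bar>Im \<delta>\<bar> * pi))"
      by (simp add: mult_left_mono)
    also have "\<dots> \<le> K * (norm s powr Re (a - b) * exp (\<bar>Im \<delta>\<bar> * pi))"
      using Q_bound[OF s] by (intro mult_right_mono) auto
    finally show "norm (Gamma (s + a) * rGamma (s + b))
          \<le> K * exp (\<bar>Im \<delta>\<bar> * pi) * norm s powr Re (a - b)"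
      by (simp add: mult_ac)
  qed
qed

text \<open>Equal lengths allow each numerator Gamma to be paired with one in the denominator: the
  factorial growth cancels and the exponents add.\<close>

lemma norm_Gamma_prod_ratio_le:
  fixes as bs :: "complex list"
  assumes "length as = length bs"
  shows "\<exists>C R. C > 0 \<and> R \<ge> 1 \<and> (\<forall>s. Re s \<ge> 0 \<longrightarrow> norm s \<ge> R \<longrightarrow>
           norm (prod_list (map (\<lambda>a. Gamma (s + a)) as) * prod_list (map (\<lambda>b. rGamma (s + b)) bs))
             \<le> C * norm s powr Re (sum_list as - sum_list bs))"
  using assms
proof (induction as bs rule: list_induct2)
  case Nil
  show ?case by (rule exI[of _ 1], rule exI[of _ 1]) auto
next
  case (Cons a as b bs)
  from Cons.IH obtain C R where CR: "C > 0" "R \<ge> 1" and bd: "\<And>s. Re s \<ge> 0 \<Longrightarrow> norm s \<ge> R \<Longrightarrow>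
           norm (prod_list (map (\<lambda>a. Gamma (s + a)) as) * prod_list (map (\<lambda>b. rGamma (s + b)) bs))
             \<le> C * norm s powr Re (sum_list as - sum_list bs)" by blast
  obtain C' R' where CR': "C' > 0" "R' \<ge> 1" and bd': "\<And>s. Re s \<ge> 0 \<Longrightarrow> norm s \<ge> R' \<Longrightarrow>
           norm (Gamma (s + a) * rGamma (s + b)) \<le> C' * norm s powr Re (a - b)"
    using norm_Gamma_ratio_le[of a b] by blast
  show ?case
  proof (rule exI[of _ "C * C'"], rule exI[of _ "max R R'"], intro conjI allI impI)
    fix s assume s: "Re s \<ge> 0" "norm s \<ge> max R R'"
    have "norm (prod_list (map (\<lambda>a. Gamma (s + a)) (a # as)) * prod_list (map (\<lambda>b. rGamma (s + b)) (b # bs)))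
        = norm (prod_list (map (\<lambda>a. Gamma (s + a)) as) * prod_list (map (\<lambda>b. rGamma (s + b)) bs))
          * norm (Gamma (s + a) * rGamma (s + b))"
      by (simp add: norm_mult mult_ac)
    also have "\<dots> \<le> (C * norm s powr Re (sum_list as - sum_list bs)) * (C' * norm s powr Re (a - b))"
      using bd[of s] bd'[of s] s CR CR' by (intro mult_mono) auto
    also have "\<dots> = C * C' * norm s powr Re (sum_list (a # as) - sum_list (b # bs))"
      by (simp add: powr_add[symmetric] algebra_simps flip: powr_add)
    finally show "norm (prod_list (map (\<lambda>a. Gamma (s + a)) (a # as)) * prod_list (map (\<lambda>b. rGamma (s + b)) (b # bs)))
       \<le> C * C' * norm s powr Re (sum_list (a # as) - sum_list (b # bs))" .
  qed (use CR CR' in auto)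
qed

section \<open>Two-sided exponential bounds for sines and for quotients of sines\<close>

lemma norm_sin_le_exp: "norm (sin (z::complex)) \<le> exp \<bar>Im z\<bar>"
proof -
  define E where "E = exp (2 * \<bar>Im z\<bar>)"
  have "exp (2 * Im z) + inverse (exp (2 * Im z)) \<le> E + 1"
    unfolding E_def by (cases "Im z \<ge> 0") (auto simp: exp_minus[symmetric])
  moreover have "- 2 * cos (2 * Re z) \<le> 2" using cos_ge_minus_one[of "2 * Re z"] by linarith
  moreover have "E \<ge> 1" by (simp add: E_def)
  ultimately have "norm (sin z) ^ 2 \<le> E"
    unfolding norm_sin_squared by simp
  also have "\<dots> = exp \<bar>Im z\<bar> ^ 2" by (simp add: E_def exp_double)
  finally show ?thesis by (rule power2_le_imp_le) simp
qed

text \<open>With E = exp(2 |Im z|) one has 4 |sin z|^2 = E + 1/E - 2 + 4 sin^2(Re z). Either the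
  last term is bounded below, or E >= 4 dominates by itself. The constant 1/3 comes from (E - 2)/4
  >= E/9 for E >= 4.\<close>

lemma norm_sin_ge_exp:
  assumes "0 < \<kappa>" "\<kappa> \<le> 1" "\<bar>sin (Re z)\<bar> \<ge> \<kappa> \<or> \<bar>Im z\<bar> \<ge> 1"
  shows "norm (sin (z::complex)) \<ge> \<kappa> / 3 * exp \<bar>Im z\<bar>"
proof -
  define E where "E = exp (2 * \<bar>Im z\<bar>)"
  have E: "E \<ge> 1" by (simp add: E_def)
  have k2: "\<kappa>\<^sup>2 \<le> 1" using assms by (simp add: power_le_one)
  have eq: "norm (sin z) ^ 2 = (E + 1 / E - 2 + 4 * sin (Re z) ^ 2) / 4"
  proof -
    have "exp (2 * Im z) + inverse (exp (2 * Im z)) = E + 1 / E"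
      unfolding E_def by (cases "Im z \<ge> 0") (auto simp: exp_minus field_simps)
    then show ?thesis unfolding norm_sin_squared cos_double_sin by simp
  qed
  have "(\<kappa> / 3)\<^sup>2 * E \<le> norm (sin z) ^ 2"
    using assms(3)
  proof
    assume "\<bar>sin (Re z)\<bar> \<ge> \<kappa>"
    then have "sin (Re z) ^ 2 \<ge> \<kappa>\<^sup>2" using assms(1) by (metis abs_le_square_iff abs_of_pos)
    moreover have "E + 1 / E - 2 \<ge> \<kappa>\<^sup>2 * (E + 1 / E - 2)"
    proof -
      have "E + 1 / E - 2 = (E - 1)\<^sup>2 / E" using E by (simp add: field_simps power2_eq_square)
      then have "E + 1 / E - 2 \<ge> 0" using E by simp
      then show ?thesis using k2 by (simp add: mult_left_le_one_le)
    qed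
    moreover have "\<kappa>\<^sup>2 * (E + 1 / E + 2) = \<kappa>\<^sup>2 * (E + 1 / E - 2) + 4 * \<kappa>\<^sup>2"
      by (simp add: algebra_simps)
    moreover define U W where "U = E + 1 / E - 2" and "W = \<kappa>\<^sup>2 * (E + 1 / E + 2)"
    ultimately have "norm (sin z) ^ 2 \<ge> W / 4"
      unfolding eq U_def[symmetric] W_def[symmetric] by simp
    then have "norm (sin z) ^ 2 \<ge> \<kappa>\<^sup>2 * (E + 1 / E + 2) / 4" unfolding W_def .
    moreover have "\<kappa>\<^sup>2 * (E + 1 / E + 2) \<ge> \<kappa>\<^sup>2 * E" using E by (intro mult_left_mono) auto
    moreover have "\<kappa>\<^sup>2 * E \<ge> 0" using E by simp
    ultimately show ?thesis by (simp add: power_divide)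
  next
    assume "\<bar>Im z\<bar> \<ge> 1"
    then have "E \<ge> exp 2" by (simp add: E_def)
    moreover have "exp (2::real) \<ge> 4"
      using exp_ge_add_one_self[of "1::real"] power_mono[of 2 "exp (1::real)" 2] by (simp add: exp_double[symmetric])
    ultimately have E4: "E \<ge> 4" by linarith
    have "norm (sin z) ^ 2 \<ge> (E - 2) / 4" unfolding eq using E by simp
    also have "(E - 2) / 4 \<ge> E / 9" using E4 by simp
    also have "E / 9 \<ge> (\<kappa> / 3)\<^sup>2 * E" using k2 E by (simp add: power_divide mult_left_le_one_le)
    finally show ?thesis .
  qed
  also have "(\<kappa> / 3)\<^sup>2 * E = (\<kappa> / 3 * exp \<bar>Im z\<bar>)\<^sup>2"
    by (simp only: E_def exp_double power_mult_distrib)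
  finally show ?thesis by (rule power2_le_imp_le) simp
qed

lemma abs_sin_add_int_pi: "k \<in> \<int> \<Longrightarrow> \<bar>sin (x + pi * k)\<bar> = \<bar>sin (x::real)\<bar>"
proof -
  assume "k \<in> \<int>"
  then have s: "sin (pi * k) = 0" using sin_times_pi_eq_0[of k] by (simp add: mult.commute)
  then have "\<bar>cos (pi * k)\<bar> = 1" using sin_cos_squared_add[of "pi * k"] by (auto simp: power2_eq_1_iff)
  then show ?thesis using s by (simp add: sin_add abs_mult)
qed

text \<open>Both sines have size exp(pi |Im s|) up to constants. On the vertical lines |sin(pi Re(s
  + y))| is the same number \<open>\<kappa>\<close> for every line, because the lines differ by
  integers; far from the real axis |Im(s + y)| >= 1 is enough.\<close>

lemma norm_sin_ratio_le:
  fixes x y :: complex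
  assumes "\<delta> + Re y \<notin> \<int>"
  shows "\<exists>C R. C > 0 \<and> R \<ge> 1 \<and> (\<forall>s. \<bar>Im s\<bar> \<ge> R \<or> Re s - \<delta> \<in> \<int> \<longrightarrow>
           norm (sin (of_real pi * (s + x))) \<le> C * norm (sin (of_real pi * (s + y))))"
proof -
  define \<kappa> where "\<kappa> = \<bar>sin (pi * (\<delta> + Re y))\<bar>"
  have \<kappa>: "\<kappa> > 0" "\<kappa> \<le> 1"
    using assms by (auto simp: \<kappa>_def sin_times_pi_eq_0 mult.commute[of pi])
  define C where "C = exp (pi * \<bar>Im x\<bar> + pi * \<bar>Im y\<bar>) / (\<kappa> / 3)"
  show ?thesis
  proof (rule exI[of _ C], rule exI[of _ "\<bar>Im y\<bar> + 1"], intro conjI allI impI)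
    fix s assume s: "\<bar>Im s\<bar> \<ge> \<bar>Im y\<bar> + 1 \<or> Re s - \<delta> \<in> \<int>"
    have alt: "\<bar>sin (Re (of_real pi * (s + y)))\<bar> \<ge> \<kappa> \<or> \<bar>Im (of_real pi * (s + y))\<bar> \<ge> 1"
    proof (cases "Re s - \<delta> \<in> \<int>")
      case True
      have "\<kappa> = \<bar>sin (pi * (\<delta> + Re y) + pi * (Re s - \<delta>))\<bar>"
        unfolding \<kappa>_def using abs_sin_add_int_pi[OF True] by simp
      then show ?thesis by (simp add: algebra_simps)
    next
      case False
      then have "\<bar>Im (s + y)\<bar> \<ge> 1" using s by auto
      moreover have "pi * \<bar>Im (s + y)\<bar> \<ge> 1 * \<bar>Im (s + y)\<bar>"
        using pi_ge_two by (intro mult_right_mono) linarith+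
      ultimately have "pi * \<bar>Im (s + y)\<bar> \<ge> 1" by linarith
      then show ?thesis by (simp add: abs_mult)
    qed
    have "norm (sin (of_real pi * (s + x))) \<le> exp (pi * \<bar>Im (s + x)\<bar>)"
      using norm_sin_le_exp[of "of_real pi * (s + x)"] by (simp add: abs_mult)
    also have "\<dots> \<le> exp ((pi * \<bar>Im x\<bar> + pi * \<bar>Im y\<bar>) + pi * \<bar>Im (s + y)\<bar>)"
    proof -
      have "\<bar>Im (s + x)\<bar> \<le> \<bar>Im x\<bar> + \<bar>Im y\<bar> + \<bar>Im (s + y)\<bar>" by simp
      then have "pi * \<bar>Im (s + x)\<bar> \<le> pi * (\<bar>Im x\<bar> + \<bar>Im y\<bar> + \<bar>Im (s + y)\<bar>)"
        by (intro mult_left_mono) auto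
      then show ?thesis by (simp add: algebra_simps)
    qed
    also have "\<dots> = C * (\<kappa> / 3 * exp (pi * \<bar>Im (s + y)\<bar>))"
      using \<kappa> by (simp add: C_def exp_add)
    also have "\<dots> \<le> C * norm (sin (of_real pi * (s + y)))"
      using norm_sin_ge_exp[OF \<kappa> alt] \<kappa> by (intro mult_left_mono) (auto simp: C_def abs_mult)
    finally show "norm (sin (of_real pi * (s + x))) \<le> C * norm (sin (of_real pi * (s + y)))" .
  qed (use \<kappa> in \<open>auto simp: C_def\<close>)
qed

lemma norm_sin_prod_ratio_le:
  fixes xs ys :: "complex list"
  assumes "length xs = length ys" "\<forall>y\<in>set ys. \<delta> + Re y \<notin> \<int>"
  shows "\<exists>C R. C > 0 \<and> R \<ge> 1 \<and> (\<forall>s. \<bar>Im s\<bar> \<ge> R \<or> Re s - \<delta> \<in> \<int> \<longrightarrow>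
           norm (prod_list (map (\<lambda>x. sin (of_real pi * (s + x))) xs))
             \<le> C * norm (prod_list (map (\<lambda>x. sin (of_real pi * (s + x))) ys)))"
  using assms
proof (induction xs ys rule: list_induct2)
  case Nil
  show ?case by (rule exI[of _ 1], rule exI[of _ 1]) auto
next
  case (Cons x xs y ys)
  let ?S = "\<lambda>s xs. norm (prod_list (map (\<lambda>x. sin (of_real pi * (s + x))) xs))"
  from Cons obtain C R where CR: "C > 0" "R \<ge> 1"
    and bd: "\<And>s. \<bar>Im s\<bar> \<ge> R \<or> Re s - \<delta> \<in> \<int> \<Longrightarrow> ?S s xs \<le> C * ?S s ys" by auto
  obtain C' R' where CR': "C' > 0" "R' \<ge> 1"
    and bd': "\<And>s. \<bar>Im s\<bar> \<ge> R' \<or> Re s - \<delta> \<in> \<int> \<Longrightarrow>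
       norm (sin (of_real pi * (s + x))) \<le> C' * norm (sin (of_real pi * (s + y)))"
    using norm_sin_ratio_le[of \<delta> y x] Cons.prems by auto
  show ?case
  proof (rule exI[of _ "C' * C"], rule exI[of _ "max R R'"], intro conjI allI impI)
    fix s assume s: "\<bar>Im s\<bar> \<ge> max R R' \<or> Re s - \<delta> \<in> \<int>"
    have "?S s (x # xs) = norm (sin (of_real pi * (s + x))) * ?S s xs"
      by (simp add: norm_mult)
    also have "\<dots> \<le> (C' * norm (sin (of_real pi * (s + y)))) * (C * ?S s ys)"
      using s CR' by (intro mult_mono bd bd') auto
    also have "\<dots> = C' * C * ?S s (y # ys)" by (simp add: norm_mult)
    finally show "?S s (x # xs) \<le> C' * C * ?S s (y # ys)" .
  qed (use CR CR' in auto)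
qed

lemma rGamma_one_minus:
  fixes z :: complex
  assumes "z \<notin> \<int>"
  shows "rGamma (1 - z) = Gamma z * (sin (of_real pi * z) / of_real pi)"
proof -
  have "rGamma z \<noteq> 0" using assms by (auto simp: rGamma_eq_zero_iff nonpos_Ints_def)
  then show ?thesis using rGamma_reflection_complex[of z]
    by (simp add: Gamma_def field_simps)
qed

lemma Gamma_one_minus:
  fixes z :: complex
  assumes "z \<notin> \<int>"
  shows "Gamma (1 - z) = rGamma z * (of_real pi / sin (of_real pi * z))"
  unfolding Gamma_def rGamma_one_minus[OF assms] by (simp add: divide_simps)

text \<open>An integer value of s + x forces Im s = - Im x, which excludes the first alternative;
  then Re s - \<delta> and Re s + Re x are both integers, hence so is \<delta> + Re x.\<close>

lemma not_Ints_of_contour: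
  fixes s x :: complex
  assumes "\<bar>Im s\<bar> > \<bar>Im x\<bar> \<or> Re s - \<delta> \<in> \<int>" "\<delta> + Re x \<notin> \<int>"
  shows "s + x \<notin> \<int>"
proof
  assume "s + x \<in> \<int>"
  then obtain n where n: "s + x = of_int n" by (auto elim: Ints_cases)
  then have im: "Im s + Im x = 0" and re: "Re s + Re x = of_int n"
    by (auto simp: complex_eq_iff)
  have "Re s - \<delta> \<in> \<int>" using assms(1) im by auto
  moreover have "\<delta> + Re x = of_int n - (Re s - \<delta>)" using re by simp
  ultimately show False using assms(2) by (metis Ints_diff Ints_of_int)
qed

text \<open>Each x forbids one class modulo 1, so the forbidden offsets are countable while the
  interval is not.\<close>

lemma exists_avoiding_offset:
  fixes X :: "complex set"
  assumes "finite X"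
  obtains \<delta> where "0 < \<delta>" "\<delta> < 1" "\<forall>x\<in>X. \<delta> + Re x \<notin> \<int>"
proof -
  have eq: "{\<delta>. \<exists>x\<in>X. \<delta> + Re x \<in> \<int>} \<subseteq> (\<Union>x\<in>X. range (\<lambda>k::int. of_int k - Re x))"
  proof safe
    fix \<delta> x assume "x \<in> X" "\<delta> + Re x \<in> \<int>"
    then obtain k where "\<delta> + Re x = of_int k" by (auto elim: Ints_cases)
    then have "\<delta> = of_int k - Re x" by simp
    then show "\<delta> \<in> (\<Union>x\<in>X. range (\<lambda>k::int. of_int k - Re x))" using \<open>x \<in> X\<close> by blast
  qed
  have "countable (\<Union>x\<in>X. range (\<lambda>k::int. of_int k - Re x))"
    using assms by (intro countable_UN countable_finite countable_image countableI_type)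
  then have "countable {\<delta>. \<exists>x\<in>X. \<delta> + Re x \<in> \<int>}" using eq countable_subset by blast
  moreover have "uncountable {0<..<(1::real)}" by (simp add: uncountable_open_interval)
  ultimately have "\<not> {0<..<1} \<subseteq> {\<delta>. \<exists>x\<in>X. \<delta> + Re x \<in> \<int>}" using countable_subset by blast
  then obtain \<delta> where "\<delta> \<in> {0<..<1}" "\<not> (\<exists>x\<in>X. \<delta> + Re x \<in> \<int>)" by blast
  then show thesis using that[of \<delta>] by auto
qed

section \<open>Rectangular contours: length estimate and residue theorem\<close>

lemma norm_contour_integral_rectpath_le:
  assumes cont: "continuous_on (path_image (rectpath a b)) f"
    and bound: "\<And>z. z \<in> path_image (rectpath a b) \<Longrightarrow> norm (f z) \<le> B"
    and le: "Re a \<le> Re b" "Im a \<le> Im b" and B: "B \<ge> 0"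
  shows "norm (contour_integral (rectpath a b) f) \<le> B * (2 * (Re b - Re a) + 2 * (Im b - Im a))"
proof -
  define a2 a4 where "a2 = Complex (Re b) (Im a)" and "a4 = Complex (Re a) (Im b)"
  have rp: "rectpath a b = linepath a a2 +++ linepath a2 b +++ linepath b a4 +++ linepath a4 a"
    by (simp add: rectpath_def Let_def a2_def a4_def)
  have pim: "path_image (rectpath a b) = closed_segment a a2 \<union> (closed_segment a2 b \<union> (closed_segment b a4 \<union> closed_segment a4 a))"
    by (simp add: rp path_image_join)
  have ci: "f contour_integrable_on linepath u v" if "closed_segment u v \<subseteq> path_image (rectpath a b)" for u v
    using that cont by (intro contour_integrable_continuous_linepath) (auto intro: continuous_on_subset)
  have bd: "norm (contour_integral (linepath u v) f) \<le> B * norm (v - u)"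
    if "closed_segment u v \<subseteq> path_image (rectpath a b)" for u v
    using that bound B by (intro contour_integral_bound_linepath ci) auto
  have sub: "closed_segment a a2 \<subseteq> path_image (rectpath a b)" "closed_segment a2 b \<subseteq> path_image (rectpath a b)"
      "closed_segment b a4 \<subseteq> path_image (rectpath a b)" "closed_segment a4 a \<subseteq> path_image (rectpath a b)"
    unfolding pim by auto
  have "contour_integral (rectpath a b) f = contour_integral (linepath a a2) f
     + (contour_integral (linepath a2 b) f + (contour_integral (linepath b a4) f + contour_integral (linepath a4 a) f))"
    unfolding rp by (simp add: contour_integrable_join ci sub contour_integral_join)
  also have "norm \<dots> \<le> B * norm (a2 - a) + (B * norm (b - a2) + (B * norm (a4 - b) + B * norm (a - a4)))"
    by (intro norm_triangle_le add_mono bd sub)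
  also have "norm (a2 - a) = Re b - Re a" using le by (simp add: a2_def cmod_def)
  also have "norm (b - a2) = Im b - Im a" using le by (simp add: a2_def cmod_def)
  also have "norm (a4 - b) = Re b - Re a" using le by (simp add: a4_def cmod_def)
  also have "norm (a - a4) = Im b - Im a" using le by (simp add: a4_def cmod_def)
  finally show ?thesis by (simp add: algebra_simps)
qed

text \<open>P may be infinite, so the residue theorem is applied in a ball around the rectangle,
  where P has finitely many points; those outside the open box have winding number 0.\<close>

lemma contour_integral_rectpath_residues:
  assumes holo: "f holomorphic_on (- P)" and fin: "\<And>r. finite (P \<inter> ball 0 r)"
    and le: "Re a \<le> Re b" "Im a \<le> Im b"
    and avoid: "P \<inter> path_image (rectpath a b) = {}"
  shows "contour_integral (rectpath a b) f = 2 * of_real pi * \<i> * (\<Sum>p\<in>P \<inter> box a b. residue f p)"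
proof -
  have "bounded (cbox a b)" by (rule bounded_cbox)
  then obtain r where r: "cbox a b \<subseteq> ball 0 r"
    by (metis bounded_subset_ballD)
  have im: "path_image (rectpath a b) \<subseteq> cbox a b"
    using le by (rule path_image_rectpath_subset_cbox)
  have "contour_integral (rectpath a b) f
     = 2 * pi * \<i> * (\<Sum>p\<in>P \<inter> ball 0 r. winding_number (rectpath a b) p * residue f p)"
  proof (rule Residue_theorem)
    show "f holomorphic_on ball 0 r - P \<inter> ball 0 r"
      using holo by (rule holomorphic_on_subset) auto
    show "path_image (rectpath a b) \<subseteq> ball 0 r - P \<inter> ball 0 r"
      using im r avoid by blast
    show "\<forall>z. z \<notin> ball 0 r \<longrightarrow> winding_number (rectpath a b) z = 0"
      using r winding_number_rectpath_outside[OF le] by blast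
  qed (use fin in auto)
  also have "(\<Sum>p\<in>P \<inter> ball 0 r. winding_number (rectpath a b) p * residue f p)
           = (\<Sum>p\<in>P \<inter> box a b. residue f p)"
  proof (rule sum.mono_neutral_cong_right)
    show "P \<inter> box a b \<subseteq> P \<inter> ball 0 r" using r box_subset_cbox by blast
    show "\<forall>p\<in>P \<inter> ball 0 r - P \<inter> box a b. winding_number (rectpath a b) p * residue f p = 0"
    proof
      fix p assume p: "p \<in> P \<inter> ball 0 r - P \<inter> box a b"
      then have "p \<notin> path_image (rectpath a b)" "p \<notin> box a b" using avoid by auto
      then have "p \<notin> cbox a b" using path_image_rectpath_cbox_minus_box[OF le] by blast
      then show "winding_number (rectpath a b) p * residue f p = 0"
        using winding_number_rectpath_outside[OF le] by simp
    qed
  qed (use fin winding_number_rectpath in auto)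
  finally show ?thesis by simp
qed

text \<open>Joins a Gamma bound to a sine bound. The division by pi^2, left over from the
  reflections, only helps because pi^2 >= 1.\<close>

lemma norm_mult_ratio_le:
  fixes Z G A B :: complex
  assumes "Z = G * (A / B) / of_real pi ^ 2" "norm G \<le> X" "norm A \<le> C * norm B" "C \<ge> 0"
  shows "norm Z \<le> X * C"
proof -
  have X: "X \<ge> 0" using assms(2) norm_ge_zero order_trans by blast
  have "1 * 1 \<le> pi * pi" using pi_ge_two by (intro mult_mono) auto
  then have pi2: "pi ^ 2 \<ge> 1" by (simp add: power2_eq_square)
  have AB: "norm A / norm B \<le> C"
    using assms(3,4) by (cases "B = 0") (auto simp: divide_le_eq)
  have "norm Z = norm G * (norm A / norm B) / pi ^ 2"
    unfolding assms(1) by (simp add: norm_mult norm_divide norm_power)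
  also have "\<dots> \<le> X * C / pi ^ 2"
    using assms(2) AB X by (intro divide_right_mono mult_mono) auto
  also have "\<dots> \<le> X * C / 1"
    using pi2 X assms(4) by (intro divide_left_mono) auto
  finally show ?thesis by simp
qed

section \<open>Reflection of whole Gamma products\<close>

lemma prod_list_rGamma_reflect:
  fixes s :: complex
  assumes "\<forall>x\<in>set xs. s + x \<notin> \<int>"
  shows "prod_list (map (\<lambda>x. rGamma (1 - x - s)) xs)
       = prod_list (map (\<lambda>x. Gamma (s + x)) xs)
         * (prod_list (map (\<lambda>x. sin (of_real pi * (s + x))) xs) / of_real pi ^ length xs)"
  using assms
proof (induction xs)
  case (Cons x xs)
  have "rGamma (1 - x - s) = Gamma (s + x) * (sin (of_real pi * (s + x)) / of_real pi)"
    using rGamma_one_minus[of "s + x"] Cons.prems by (simp add: algebra_simps)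
  with Cons show ?case by simp
qed simp

lemma prod_list_Gamma_reflect:
  fixes s :: complex
  assumes "\<forall>x\<in>set xs. s + x \<notin> \<int>"
  shows "prod_list (map (\<lambda>x. Gamma (1 - x - s)) xs)
       = prod_list (map (\<lambda>x. rGamma (s + x)) xs)
         * (of_real pi ^ length xs / prod_list (map (\<lambda>x. sin (of_real pi * (s + x))) xs))"
  using assms
proof (induction xs)
  case (Cons x xs)
  have "Gamma (1 - x - s) = rGamma (s + x) * (of_real pi / sin (of_real pi * (s + x)))"
    using Gamma_one_minus[of "s + x"] Cons.prems by (simp add: algebra_simps)
  with Cons show ?case by simp
qed simp

section \<open>The integrand and its decay\<close>

text \<open>Here \<open>c0, d0\<close> are the components \<open>c\<^sub>1, d\<^sub>1\<close> of the parameter vectors and \<open>cs, ds\<close> are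
  \<open>c\<close> and \<open>d\<close> with that component removed.\<close>

locale barnes_integrand =
  fixes m :: nat and c0 d0 :: complex and cs ds :: "complex list"
  assumes len: "length cs = length ds + 2"
    and c0_nonint: "c0 \<notin> \<int>" and d0_nonint: "d0 \<notin> \<int>"
    and cs_nonint: "\<forall>x\<in>set cs. x \<notin> \<int>" and ds_nonint: "\<forall>x\<in>set ds. x \<notin> \<int>"
    and cs_c0: "\<forall>x\<in>set cs. x - c0 \<notin> \<int>"
    and d0_c0: "d0 - c0 \<notin> \<int>" and ds_c0: "\<forall>x\<in>set ds. x - c0 \<notin> \<int>"
    and ds_d0: "\<forall>x\<in>set ds. x - d0 \<notin> \<int>"
    and ds_ds: "\<And>i j. i < length ds \<Longrightarrow> j < length ds \<Longrightarrow> i \<noteq> j \<Longrightarrow> ds ! i - ds ! j \<notin> \<int>"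
    and Re_excess: "Re (d0 + sum_list ds - (c0 + sum_list cs)) > - real m - 1"
begin

text \<open>The part of the integrand that is regular at every integer. By reflection and up to
  powers of pi, \<open>rGamma (1 - x - s)\<close> is Gamma(x + s) times the sine cancelling its
  poles, and \<open>Gamma (1 - x - s)\<close> is 1/Gamma(x + s) divided by its sine; writing them
  this way makes the cancellations automatic.\<close>

definition H :: "complex \<Rightarrow> complex" where
  "H s = Gamma (c0 + s) * rGamma (d0 + s) * prod_list (map (\<lambda>x. rGamma (1 - x - s)) cs)
         * prod_list (map (\<lambda>x. Gamma (1 - x - s)) ds)"

text \<open>By the reflection formula \<open>\<Phi>\<close> is, up to a constant, the product of \<open>g\<close> and the periodic factor,
  written so that only the genuine poles remain visible; the numerator \<open>V\<close> is holomorphic at every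
  integer \<open>n\<close>, so the residue of \<open>\<Phi>\<close> there is \<open>deriv V n / pi\<^sup>2\<close>.\<close>

definition V :: "complex \<Rightarrow> complex" where
  "V s = H s * (rGamma (1 + of_nat m + s) * rGamma (1 + s))"

definition \<Phi> :: "complex \<Rightarrow> complex" where
  "\<Phi> s = V s / sin (of_real pi * s) ^ 2"

text \<open>The exponent -1 - sigma of the decay: the sum of the numerator parameters minus that of
  the denominator parameters, where 1 + m and 1 account for - m - 2.\<close>

definition \<epsilon> :: real where
  "\<epsilon> = Re (c0 + sum_list cs - (d0 + sum_list ds)) - real m - 2"

lemma \<epsilon>_less: "\<epsilon> < -1"
  using Re_excess by (simp add: \<epsilon>_def)

text \<open>Undoing the reflections gives a Gamma quotient \<open>?G\<close> times a quotient of
  sines, in which the two zeros of \<open>ds @ [0, 0]\<close> stand for sin^2(pi s). By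
  \<open>len\<close> both quotients are balanced, as the growth lemmas demand.\<close>

lemma \<Phi>_decay_right:
  assumes "\<forall>x\<in>set (0 # ds @ cs). \<delta> + Re x \<notin> \<int>"
  shows "\<exists>C R. C > 0 \<and> R \<ge> 1 \<and> (\<forall>s. Re s \<ge> 0 \<longrightarrow> norm s \<ge> R \<longrightarrow> \<bar>Im s\<bar> \<ge> R \<or> Re s - \<delta> \<in> \<int> \<longrightarrow>
           norm (\<Phi> s) \<le> C * norm s powr \<epsilon>)"
proof -
  let ?as = "c0 # cs" and ?bs = "d0 # ds @ [1 + of_nat m, 1]"
  let ?G = "\<lambda>s. prod_list (map (\<lambda>a. Gamma (s + a)) ?as) * prod_list (map (\<lambda>b. rGamma (s + b)) ?bs)"
  let ?S = "\<lambda>s xs. prod_list (map (\<lambda>x. sin (of_real pi * (s + x))) xs)"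
  have "Re (sum_list ?as - sum_list ?bs) = \<epsilon>" by (simp add: \<epsilon>_def)
  then obtain C R where CR: "C > 0" "R \<ge> 1"
    and G: "\<And>s. Re s \<ge> 0 \<Longrightarrow> norm s \<ge> R \<Longrightarrow> norm (?G s) \<le> C * norm s powr \<epsilon>"
    using norm_Gamma_prod_ratio_le[of ?as ?bs] len by auto
  have "length cs = length (ds @ [0, 0])" "\<forall>y\<in>set (ds @ [0, 0]). \<delta> + Re y \<notin> \<int>"
    using len assms by auto
  from norm_sin_prod_ratio_le[OF this] obtain C' R' where CR': "C' > 0" "R' \<ge> 1"
    and S: "\<And>s. \<bar>Im s\<bar> \<ge> R' \<or> Re s - \<delta> \<in> \<int> \<Longrightarrow> norm (?S s cs) \<le> C' * norm (?S s (ds @ [0, 0]))"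
    by blast
  define M where "M = (\<Sum>x\<in>set (ds @ cs). \<bar>Im x\<bar>) + 1"
  have M: "\<bar>Im x\<bar> < M" if "x \<in> set (ds @ cs)" for x
    using member_le_sum[of x "set (ds @ cs)" "\<lambda>x. \<bar>Im x\<bar>"] that by (simp add: M_def)
  show ?thesis
  proof (rule exI[of _ "C * C'"], rule exI[of _ "max M (max R R')"], intro conjI allI impI)
    fix s assume s: "Re s \<ge> 0" "norm s \<ge> max M (max R R')"
       "\<bar>Im s\<bar> \<ge> max M (max R R') \<or> Re s - \<delta> \<in> \<int>"
    have ni: "s + x \<notin> \<int>" if "x \<in> set (ds @ cs)" for x
    proof (rule not_Ints_of_contour)
      show "\<bar>Im s\<bar> > \<bar>Im x\<bar> \<or> Re s - \<delta> \<in> \<int>" using s M[OF that] by linarith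
      show "\<delta> + Re x \<notin> \<int>" using assms that by auto
    qed
    have eq: "\<Phi> s = ?G s * (?S s cs / ?S s (ds @ [0, 0])) / of_real pi ^ 2"
      using prod_list_rGamma_reflect[of cs s] prod_list_Gamma_reflect[of ds s] ni
      by (simp add: \<Phi>_def V_def H_def len power2_eq_square add_ac mult_ac)
    have "norm (\<Phi> s) \<le> (C * norm s powr \<epsilon>) * C'"
      using CR' s by (intro norm_mult_ratio_le[OF eq] G S) auto
    then show "norm (\<Phi> s) \<le> C * C' * norm s powr \<epsilon>" by (simp add: mult_ac)
  qed (use CR CR' in auto)
qed

text \<open>Reflecting all factors but those for \<open>cs\<close> and \<open>ds\<close> expresses \<open>\<Phi> (- t)\<close> through Gamma quotients in the
  right half-plane again.\<close>

lemma \<Phi>_decay_left: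
  assumes "\<forall>x\<in>set [0, c0, d0]. \<delta> + Re x \<notin> \<int>"
  shows "\<exists>C R. C > 0 \<and> R \<ge> 1 \<and> (\<forall>s. Re s \<le> 0 \<longrightarrow> norm s \<ge> R \<longrightarrow> \<bar>Im s\<bar> \<ge> R \<or> Re s - \<delta> \<in> \<int> \<longrightarrow>
           norm (\<Phi> s) \<le> C * norm s powr \<epsilon>)"
proof -
  let ?as = "(1 - d0) # map (\<lambda>x. 1 - x) ds @ [- of_nat m, 0]" and ?bs = "(1 - c0) # map (\<lambda>x. 1 - x) cs"
  let ?G = "\<lambda>s. prod_list (map (\<lambda>a. Gamma (s + a)) ?as) * prod_list (map (\<lambda>b. rGamma (s + b)) ?bs)"
  let ?S = "\<lambda>s xs. prod_list (map (\<lambda>x. sin (of_real pi * (s + x))) xs)"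
  have sum1: "sum_list (map (\<lambda>x. 1 - x) xs) = of_nat (length xs) - sum_list xs" for xs :: "complex list"
    by (induction xs) auto
  \<comment> \<open>Replacing each parameter x by 1 - x contributes the difference of the counts,
    which is -2, so the exponent agrees with that of the right half-plane.\<close>
  have "Re (sum_list ?as - sum_list ?bs) = \<epsilon>" by (simp add: \<epsilon>_def sum1 len)
  then obtain C R where CR: "C > 0" "R \<ge> 1"
    and G: "\<And>s. Re s \<ge> 0 \<Longrightarrow> norm s \<ge> R \<Longrightarrow> norm (?G s) \<le> C * norm s powr \<epsilon>"
    using norm_Gamma_prod_ratio_le[of ?as ?bs] len by auto
  have neg: "-\<delta> + Re (1 - x) \<notin> \<int>" if "\<delta> + Re x \<notin> \<int>" for x
  proof
    assume "-\<delta> + Re (1 - x) \<in> \<int>"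
    then have "1 - (-\<delta> + Re (1 - x)) \<in> \<int>" by (intro Ints_diff) auto
    then show False using that by (simp add: add.commute)
  qed
  have neg0: "-\<delta> \<notin> \<int>" "-\<delta> + - real m \<notin> \<int>"
  proof -
    have "\<delta> \<notin> \<int>" using assms by simp
    then show "-\<delta> \<notin> \<int>" by simp
    then show "-\<delta> + - real m \<notin> \<int>"
      using Ints_add[of "-\<delta> + - real m" "real m"] by auto
  qed
  have avoid: "\<forall>y\<in>set [1 - c0, 0, 0]. -\<delta> + Re y \<notin> \<int>" and avoid': "\<forall>y\<in>set [1 - c0, 1 - d0, 0, - of_nat m]. -\<delta> + Re y \<notin> \<int>"
    using neg[of c0] neg[of d0] neg0 assms by auto
  \<comment> \<open>The three reflected reciprocal Gammas put sines above; below are the sine from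
    \<open>Gamma (c0 + s)\<close> and the two of sin^2(pi s). The balance is three against
    three.\<close>
  have "length [1 - d0, - of_nat m, 0] = length [1 - c0, 0, 0]" by simp
  from norm_sin_prod_ratio_le[OF this avoid] obtain C' R' where CR': "C' > 0" "R' \<ge> 1"
    and S: "\<And>s. \<bar>Im s\<bar> \<ge> R' \<or> Re s - (-\<delta>) \<in> \<int> \<Longrightarrow>
        norm (?S s [1 - d0, - of_nat m, 0]) \<le> C' * norm (?S s [1 - c0, 0, 0])"
    by blast
  define M where "M = \<bar>Im c0\<bar> + \<bar>Im d0\<bar> + 1"
  show ?thesis
  proof (rule exI[of _ "C * C'"], rule exI[of _ "max M (max R R')"], intro conjI allI impI)
    fix s assume s: "Re s \<le> 0" "norm s \<ge> max M (max R R')"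
       "\<bar>Im s\<bar> \<ge> max M (max R R') \<or> Re s - \<delta> \<in> \<int>"
    define t where "t = - s"
    have "Re t - (-\<delta>) = - (Re s - \<delta>)" by (simp add: t_def)
    then have "Re t - (-\<delta>) \<in> \<int> \<longleftrightarrow> Re s - \<delta> \<in> \<int>" by (metis Ints_minus minus_minus)
    then have t: "Re t \<ge> 0" "norm t \<ge> max M (max R R')"
       "\<bar>Im t\<bar> \<ge> max M (max R R') \<or> Re t - (-\<delta>) \<in> \<int>"
      using s unfolding t_def by auto
    have ni: "t + x \<notin> \<int>" if "x \<in> set [1 - c0, 1 - d0, 0, - of_nat m]" for x
    proof (rule not_Ints_of_contour)
      have "\<bar>Im x\<bar> < M" using that by (auto simp: M_def)
      then show "\<bar>Im t\<bar> > \<bar>Im x\<bar> \<or> Re t - (-\<delta>) \<in> \<int>" using t by linarith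
      show "-\<delta> + Re x \<notin> \<int>" using avoid' that by blast
    qed
    have 1: "Gamma (c0 + s) = rGamma (t + (1 - c0)) * (of_real pi / sin (of_real pi * (t + (1 - c0))))"
      using Gamma_one_minus[of "t + (1 - c0)"] ni by (simp add: t_def)
    have 2: "rGamma (d0 + s) = Gamma (t + (1 - d0)) * (sin (of_real pi * (t + (1 - d0))) / of_real pi)"
      using rGamma_one_minus[of "t + (1 - d0)"] ni by (simp add: t_def)
    have 3: "rGamma (1 + of_nat m + s) = Gamma (t + - of_nat m) * (sin (of_real pi * (t + - of_nat m)) / of_real pi)"
      using rGamma_one_minus[OF ni[of "- of_nat m"]] by (simp add: t_def algebra_simps)
    have 4: "rGamma (1 + s) = Gamma (t + 0) * (sin (of_real pi * (t + 0)) / of_real pi)"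
      using rGamma_one_minus[OF ni[of 0]] by (simp add: t_def)
    have 5: "sin (of_real pi * s) = - sin (of_real pi * (t + 0))" by (simp add: t_def)
    have 6: "map (\<lambda>x. rGamma (1 - x - s)) cs = map (\<lambda>b. rGamma (t + b)) (map (\<lambda>x. 1 - x) cs)"
      and 7: "map (\<lambda>x. Gamma (1 - x - s)) ds = map (\<lambda>b. Gamma (t + b)) (map (\<lambda>x. 1 - x) ds)"
      by (simp_all add: t_def algebra_simps)
    have eq: "\<Phi> s = ?G t * (?S t [1 - d0, - of_nat m, 0] / ?S t [1 - c0, 0, 0]) / of_real pi ^ 2"
      unfolding \<Phi>_def V_def H_def 1 2 3 4 5 6 7
      by (simp add: power2_eq_square mult_ac)
    have "norm (\<Phi> s) \<le> (C * norm t powr \<epsilon>) * C'"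
      using CR' t by (intro norm_mult_ratio_le[OF eq] G S) auto
    then show "norm (\<Phi> s) \<le> C * C' * norm s powr \<epsilon>" by (simp add: mult_ac t_def)
  qed (use CR CR' in auto)
qed

lemma \<Phi>_decay:
  assumes "\<forall>x\<in>set (0 # c0 # d0 # ds @ cs). \<delta> + Re x \<notin> \<int>"
  shows "\<exists>C R. C > 0 \<and> R \<ge> 1 \<and> (\<forall>s. norm s \<ge> R \<longrightarrow> \<bar>Im s\<bar> \<ge> R \<or> Re s - \<delta> \<in> \<int> \<longrightarrow>
           norm (\<Phi> s) \<le> C * norm s powr \<epsilon>)"
proof -
  from assms obtain C R where CR: "C > 0" "R \<ge> 1" and
     r: "\<And>s. Re s \<ge> 0 \<Longrightarrow> norm s \<ge> R \<Longrightarrow> \<bar>Im s\<bar> \<ge> R \<or> Re s - \<delta> \<in> \<int> \<Longrightarrow> norm (\<Phi> s) \<le> C * norm s powr \<epsilon>"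
    using \<Phi>_decay_right[of \<delta>] by auto
  from assms obtain C' R' where CR': "C' > 0" "R' \<ge> 1" and
     l: "\<And>s. Re s \<le> 0 \<Longrightarrow> norm s \<ge> R' \<Longrightarrow> \<bar>Im s\<bar> \<ge> R' \<or> Re s - \<delta> \<in> \<int> \<Longrightarrow> norm (\<Phi> s) \<le> C' * norm s powr \<epsilon>"
    using \<Phi>_decay_left[of \<delta>] by auto
  show ?thesis
  proof (rule exI[of _ "max C C'"], rule exI[of _ "max R R'"], intro conjI allI impI)
    fix s assume s: "norm s \<ge> max R R'" "\<bar>Im s\<bar> \<ge> max R R' \<or> Re s - \<delta> \<in> \<int>"
    have "C * norm s powr \<epsilon> \<le> max C C' * norm s powr \<epsilon>" "C' * norm s powr \<epsilon> \<le> max C C' * norm s powr \<epsilon>"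
      by (intro mult_right_mono; simp)+
    then show "norm (\<Phi> s) \<le> max C C' * norm s powr \<epsilon>"
      using r[of s] l[of s] s by (cases "Re s \<ge> 0") auto
  qed (use CR in auto)
qed

end

section \<open>Residues\<close>

lemma sin_squared_diff_of_int: "sin (of_real pi * (s - of_int n)) ^ 2 = sin (of_real pi * (s::complex)) ^ 2"
proof -
  have s: "sin (of_real pi * of_int n :: complex) = 0"
    by (metis of_real_0 of_real_mult of_real_of_int_eq sin_npi_int sin_of_real)
  then have "cos (of_real pi * of_int n :: complex) ^ 2 = 1"
    using sin_cos_squared_add[of "of_real pi * of_int n :: complex"] by simp
  then show ?thesis using s by (simp add: right_diff_distrib sin_diff power_mult_distrib)
qed

text \<open>The sine has no quadratic term at its zero: sin^2(pi s) = pi^2 h(s)^2 (s - n)^2 with h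
  entire, h(n) = 1 and h'(n) = 0. So the denominator contributes nothing to the derivative that
  gives the residue.\<close>

lemma residue_over_sin_squared:
  assumes "f analytic_on {of_int n}"
  shows "residue (\<lambda>s. f s / sin (of_real pi * s) ^ 2) (of_int n) = deriv f (of_int n) / of_real pi ^ 2"
proof -
  let ?z = "of_int n :: complex"
  \<comment> \<open>\<open>g\<close> is sin z / z with its removable singularity filled in, which
    makes \<open>h\<close> entire.\<close>
  define g where "g = (\<lambda>z::complex. if z = 0 then 1 else sin z / z)"
  have g0: "(g has_field_derivative 0) (at 0)"
    unfolding g_def by (rule has_field_derivative_sin_z_over_z)
  have gz: "g field_differentiable at z" if "z \<noteq> 0" for z
  proof -
    have "(\<lambda>z. sin z / z) field_differentiable at z"
      using that by (intro field_differentiable_divide field_differentiable_at_sin field_differentiable_ident)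
    then obtain D where "((\<lambda>z. sin z / z) has_field_derivative D) (at z)"
      by (auto simp: field_differentiable_def)
    then have "(g has_field_derivative D) (at z)"
      by (rule has_field_derivative_transform_within_open[where S = "- {0}"])
         (use that in \<open>auto simp: g_def\<close>)
    then show ?thesis by (auto simp: field_differentiable_def)
  qed
  have g_holo: "g holomorphic_on UNIV"
    unfolding holomorphic_on_def using g0 gz by (metis field_differentiable_def)
  define h where "h = (\<lambda>s. g (of_real pi * (s - ?z)))"
  have h_holo: "h holomorphic_on A" for A
    unfolding h_def
    by (rule holomorphic_on_compose_gen[OF _ g_holo, unfolded o_def]) (auto intro!: holomorphic_intros)
  have h_deriv: "(h has_field_derivative 0) (at ?z)"
  proof -
    have "((\<lambda>s. of_real pi * (s - ?z)) has_field_derivative of_real pi) (at ?z)"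
      by (auto intro!: derivative_eq_intros)
    moreover have "(g has_field_derivative 0) (at (of_real pi * (?z - ?z)))" using g0 by simp
    ultimately show ?thesis unfolding h_def using DERIV_chain2 by fastforce
  qed
  have hz: "h ?z = 1" by (simp add: h_def g_def)
  have sin_eq: "sin (of_real pi * s) ^ 2 = of_real pi ^ 2 * h s ^ 2 * (s - ?z) ^ 2" for s
  proof (cases "s = ?z")
    case True
    then show ?thesis using sin_squared_diff_of_int[of s n] by simp
  next
    case False
    then show ?thesis
      using sin_squared_diff_of_int[of s n] by (simp add: h_def g_def power_divide power_mult_distrib)
  qed
  obtain A where A: "open A" "?z \<in> A" "f holomorphic_on A"
    using assms analytic_at by blast
  have "continuous_on UNIV h" using h_holo holomorphic_on_imp_continuous_on by blast
  then have "open (h -` (- {0}))" by (intro open_vimage) auto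
  then have open': "open (A \<inter> h -` (- {0}))" using A by blast
  define F where "F = (\<lambda>s. f s / (of_real pi ^ 2 * h s ^ 2))"
  have "residue (\<lambda>s. f s / sin (of_real pi * s) ^ 2) ?z = residue (\<lambda>s. F s / (s - ?z) ^ Suc 1) ?z"
    unfolding sin_eq F_def by (simp add: numeral_2_eq_2)
  also have "\<dots> = (deriv ^^ 1) F ?z / fact 1"
  proof (rule residue_holomorphic_over_power[OF open'])
    show "F holomorphic_on A \<inter> h -` (- {0})"
      unfolding F_def using A(3) h_holo by (intro holomorphic_intros) (auto intro: holomorphic_on_subset)
  qed (use A hz in auto)
  also have "(deriv ^^ 1) F ?z / fact 1 = deriv F ?z" by simp
  also have "deriv F ?z = deriv f ?z / of_real pi ^ 2"
  proof (rule DERIV_imp_deriv)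
    have "(f has_field_derivative deriv f ?z) (at ?z)"
      using A holomorphic_derivI by blast
    then show "(F has_field_derivative deriv f ?z / of_real pi ^ 2) (at ?z)"
      unfolding F_def using h_deriv hz
      by (auto intro!: derivative_eq_intros simp: field_simps power2_eq_square)
  qed
  finally show ?thesis by simp
qed

lemma tendsto_Gamma_mult_at_pole:
  assumes "a = - of_nat n"
  shows "((\<lambda>z::complex. Gamma z * (z - a)) \<longlongrightarrow> (-1) ^ n / fact n) (at a)"
  using Gamma_residues[of n, where ?'a = complex] assms by simp

text \<open>The sign \<sigma> treats \<open>Gamma (c0 + s)\<close> and
  \<open>Gamma (1 - x - s)\<close> together; the factor \<sigma> in the result is 1/\<sigma>, from
  the inner derivative.\<close>

lemma residue_Gamma_mult:
  assumes g: "g analytic_on {z0}" and z0: "a + \<sigma> * z0 = - of_nat n" and \<sigma>: "\<sigma> = 1 \<or> \<sigma> = -1"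
  shows "residue (\<lambda>s. Gamma (a + \<sigma> * s) * g s) z0 = \<sigma> * (-1) ^ n / fact n * g z0"
proof -
  obtain A where A: "open A" "z0 \<in> A" "g holomorphic_on A"
    using g analytic_at by blast
  have \<sigma>2: "\<sigma> * \<sigma> = 1" "\<sigma> \<noteq> 0" "norm \<sigma> = 1" using \<sigma> by auto
  have eq: "a + \<sigma> * s = \<sigma> * (s - z0) - of_nat n" for s
  proof -
    have "a = (a + \<sigma> * z0) - \<sigma> * z0" by simp
    then have a: "a = - of_nat n - \<sigma> * z0" unfolding z0 .
    show ?thesis by (subst a) (simp add: algebra_simps)
  qed
  show ?thesis
  \<comment> \<open>The poles of \<open>Gamma (a + \<sigma> * s)\<close> have spacing 1, so the unit
    ball contains no other one.\<close>
  proof (rule residue_simple'[where s = "A \<inter> ball z0 1"])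
    show "(\<lambda>s. Gamma (a + \<sigma> * s) * g s) holomorphic_on A \<inter> ball z0 1 - {z0}"
    proof (intro holomorphic_intros)
      fix s assume s: "s \<in> A \<inter> ball z0 1 - {z0}"
      show "a + \<sigma> * s \<notin> \<int>\<^sub>\<le>\<^sub>0"
      proof
        assume "a + \<sigma> * s \<in> \<int>\<^sub>\<le>\<^sub>0"
        then obtain k where "a + \<sigma> * s = - of_nat k" by (elim nonpos_Ints_cases')
        then have k: "\<sigma> * (s - z0) = of_int (int n - int k)" unfolding eq by (simp add: algebra_simps)
        then have "norm (s - z0) = \<bar>of_int (int n - int k)\<bar>"
          using \<sigma>2 by (metis mult_1 norm_mult norm_of_int)
        moreover have "norm (s - z0) < 1" using s by (simp add: dist_norm norm_minus_commute)
        ultimately have "int n - int k = 0" by linarith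
        then show False using k s \<sigma>2 by simp
      qed
    qed (use A in \<open>auto intro: holomorphic_on_subset\<close>)
    have inner: "filterlim (\<lambda>s. a + \<sigma> * s) (at (- of_nat n)) (at z0)"
    proof (rule filterlim_atI)
      have "((\<lambda>s. a + \<sigma> * s) \<longlongrightarrow> a + \<sigma> * z0) (at z0)" by (intro tendsto_intros)
      then show "((\<lambda>s. a + \<sigma> * s) \<longlongrightarrow> - of_nat n) (at z0)" using z0 by simp
      show "\<forall>\<^sub>F x in at z0. a + \<sigma> * x \<noteq> - of_nat n"
        unfolding eq eventually_at_filter using \<sigma>2 by auto
    qed
    have "((\<lambda>s. Gamma (a + \<sigma> * s) * (a + \<sigma> * s - (- of_nat n))) \<longlongrightarrow> (-1) ^ n / fact n) (at z0)"
      by (rule filterlim_compose[OF tendsto_Gamma_mult_at_pole[OF refl] inner])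
    moreover have "g \<midarrow>z0\<rightarrow> g z0"
      using A holomorphic_on_imp_continuous_on by (metis continuous_on_eq_continuous_at isContD)
    ultimately have "((\<lambda>s. \<sigma> * (Gamma (a + \<sigma> * s) * (a + \<sigma> * s - (- of_nat n)) * g s))
        \<longlongrightarrow> \<sigma> * ((-1) ^ n / fact n * g z0)) (at z0)"
      by (intro tendsto_intros)
    moreover have "\<sigma> * (Gamma (a + \<sigma> * s) * (a + \<sigma> * s - (- of_nat n)) * g s)
          = Gamma (a + \<sigma> * s) * g s * (s - z0)" for s
    proof -
      have e: "\<sigma> * (a + \<sigma> * s - (- of_nat n)) = s - z0"
        unfolding eq using \<sigma>2 by (simp add: mult.assoc[symmetric])
      have "\<sigma> * (Gamma (a + \<sigma> * s) * (a + \<sigma> * s - (- of_nat n)) * g s)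
          = Gamma (a + \<sigma> * s) * g s * (\<sigma> * (a + \<sigma> * s - (- of_nat n)))"
        by (simp only: mult_ac)
      then show ?thesis unfolding e .
    qed
    ultimately have "((\<lambda>s. Gamma (a + \<sigma> * s) * g s * (s - z0))
        \<longlongrightarrow> \<sigma> * ((-1) ^ n / fact n * g z0)) (at z0)" by (simp only:)
    then show "((\<lambda>s. Gamma (a + \<sigma> * s) * g s * (s - z0))
        \<longlongrightarrow> \<sigma> * (-1) ^ n / fact n * g z0) (at z0)"
      by (simp only: mult.assoc times_divide_eq_right times_divide_eq_left)
  qed (use A in auto)
qed

lemma analytic_on_prod_list:
  assumes "\<And>x. x \<in> set xs \<Longrightarrow> f x analytic_on A"
  shows "(\<lambda>s. prod_list (map (\<lambda>x. f x s) xs)) analytic_on A"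
  using assms by (induction xs) (auto intro!: analytic_intros)

lemma prod_list_map_drop_nth:
  fixes f :: "'a \<Rightarrow> 'b::comm_monoid_mult"
  assumes "i < length xs"
  shows "prod_list (map f xs) = f (xs ! i) * prod_list (map f (drop_nth i xs))"
proof -
  have "prod_list (map f xs) = prod_list (map f (take i xs @ xs ! i # drop (Suc i) xs))"
    using id_take_nth_drop[OF assms] by simp
  then show ?thesis by (simp add: drop_nth_def mult_ac)
qed

lemma in_set_drop_nthE:
  assumes "x \<in> set (drop_nth i xs)"
  obtains j where "j < length xs" "j \<noteq> i" "x = xs ! j"
proof -
  from assms consider "x \<in> set (take i xs)" | "x \<in> set (drop (Suc i) xs)"
    by (auto simp: drop_nth_def)
  then show thesis
  proof cases
    case 1
    then obtain j where "j < length xs" "j < i" "x = xs ! j" by (auto simp: in_set_conv_nth)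
    then show thesis using that by auto
  next
    case 2
    then obtain j where "j < length (drop (Suc i) xs)" "x = drop (Suc i) xs ! j"
      by (auto simp only: in_set_conv_nth)
    then show thesis using that[of "Suc i + j"] by auto
  qed
qed

lemma finite_int_translate_ball: "finite ({p. p + x \<in> \<int>} \<inter> ball (0::complex) r)"
proof -
  have "{p. p + x \<in> \<int>} \<inter> ball 0 r \<subseteq> (\<lambda>n. of_int n - x) ` {-\<lceil>r + norm x\<rceil>..\<lceil>r + norm x\<rceil>}"
  proof
    fix p assume p: "p \<in> {p. p + x \<in> \<int>} \<inter> ball 0 r"
    then obtain n where n: "p + x = of_int n" by (auto elim: Ints_cases)
    have "\<bar>of_int n\<bar> = norm (p + x)" using n by simp
    also have "\<dots> \<le> r + norm x" using p norm_triangle_ineq[of p x] by simp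
    finally have "n \<in> {-\<lceil>r + norm x\<rceil>..\<lceil>r + norm x\<rceil>}" by (simp add: abs_le_iff) linarith
    moreover have "p = of_int n - x" using n by (simp add: algebra_simps)
    ultimately show "p \<in> (\<lambda>n. of_int n - x) ` {-\<lceil>r + norm x\<rceil>..\<lceil>r + norm x\<rceil>}" by blast
  qed
  then show ?thesis by (rule finite_subset) simp
qed

lemma nonpos_Ints_imp_Ints: "x \<in> \<int>\<^sub>\<le>\<^sub>0 \<Longrightarrow> x \<in> \<int>"
  by (auto elim: nonpos_Ints_cases)

lemma sin_pi_mult_nonzero: "z \<notin> \<int> \<Longrightarrow> sin (of_real pi * z :: complex) \<noteq> 0"
proof
  assume z: "z \<notin> \<int>" and "sin (of_real pi * z) = 0"
  then have "rGamma z * rGamma (1 - z) = 0" using rGamma_reflection_complex[of z] by simp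
  then have "z \<in> \<int> \<or> 1 - z \<in> \<int>" by (auto simp: rGamma_eq_zero_iff nonpos_Ints_imp_Ints)
  then show False using z Ints_diff[of 1 "1 - z"] by auto
qed

context barnes_integrand
begin

lemma V_analytic:
  assumes "\<And>n. z \<noteq> - c0 - of_nat n" "\<And>x n. x \<in> set ds \<Longrightarrow> z \<noteq> 1 - x + of_nat n"
  shows "V analytic_on {z}"
proof -
  have "c0 + z \<notin> \<int>\<^sub>\<le>\<^sub>0"
  proof
    assume "c0 + z \<in> \<int>\<^sub>\<le>\<^sub>0"
    then obtain n where "c0 + z = - of_nat n" by (elim nonpos_Ints_cases')
    then have "z = - c0 - of_nat n" by (simp add: algebra_simps eq_neg_iff_add_eq_0)
    then show False using assms(1) by blast
  qed
  moreover have "1 - x - z \<notin> \<int>\<^sub>\<le>\<^sub>0" if "x \<in> set ds" for x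
  proof
    assume "1 - x - z \<in> \<int>\<^sub>\<le>\<^sub>0"
    then obtain n where "1 - x - z = - of_nat n" by (elim nonpos_Ints_cases')
    then have "z = 1 - x + of_nat n" by (simp add: algebra_simps)
    then show False using assms(2) that by blast
  qed
  ultimately show ?thesis
    unfolding V_def[abs_def] H_def
    by (intro analytic_intros analytic_on_prod_list) auto
qed

lemma V_analytic_int: "V analytic_on {of_int n}"
proof (rule V_analytic)
  fix k show "of_int n \<noteq> - c0 - of_nat k"
  proof
    assume "of_int n = - c0 - of_nat k"
    then have "c0 = - of_int n - of_nat k" by simp
    then have "c0 = of_int (- n - int k)" by simp
    then show False using c0_nonint by simp
  qed
next
  fix x k assume x: "x \<in> set ds"
  show "of_int n \<noteq> 1 - x + of_nat k"
  proof
    assume "of_int n = 1 - x + of_nat k"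
    then have "x = of_int (1 + int k - n)" by (simp add: algebra_simps)
    then have "x \<in> \<int>" by (metis Ints_of_int)
    then show False using ds_nonint x by blast
  qed
qed

lemma residue_int: "residue \<Phi> (of_int n) = deriv V (of_int n) / of_real pi ^ 2"
  unfolding \<Phi>_def[abs_def] by (rule residue_over_sin_squared[OF V_analytic_int])

text \<open>The cofactor of \<open>Gamma (c0 + s)\<close> in \<open>\<Phi>\<close>. It is analytic
  at the poles -c0 - n because c0 and its differences with the entries of \<open>ds\<close> are not
  integers.\<close>

definition rest_c where
  "rest_c s = rGamma (d0 + s) * prod_list (map (\<lambda>x. rGamma (1 - x - s)) cs)
         * prod_list (map (\<lambda>x. Gamma (1 - x - s)) ds) * (rGamma (1 + of_nat m + s) * rGamma (1 + s))
         / sin (of_real pi * s) ^ 2"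

definition rest_d where
  "rest_d i s = Gamma (c0 + s) * rGamma (d0 + s) * prod_list (map (\<lambda>x. rGamma (1 - x - s)) cs)
         * prod_list (map (\<lambda>x. Gamma (1 - x - s)) (drop_nth i ds)) * (rGamma (1 + of_nat m + s) * rGamma (1 + s))
         / sin (of_real pi * s) ^ 2"

lemma residue_c0: "residue \<Phi> (- c0 - of_nat n) = (-1) ^ n / fact n * rest_c (- c0 - of_nat n)"
proof -
  let ?z = "- c0 - of_nat n"
  have "?z \<notin> \<int>"
  proof
    assume "?z \<in> \<int>"
    then have "- (?z + of_nat n) \<in> \<int>" by (intro Ints_minus Ints_add) auto
    then show False using c0_nonint by simp
  qed
  then have s: "sin (of_real pi * ?z) \<noteq> 0" by (rule sin_pi_mult_nonzero)
  have 1: "1 - x - ?z \<notin> \<int>\<^sub>\<le>\<^sub>0" if "x \<in> set ds" for x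
  proof
    assume "1 - x - ?z \<in> \<int>\<^sub>\<le>\<^sub>0"
    from Ints_diff[OF Ints_add[OF Ints_1 Ints_of_nat] nonpos_Ints_imp_Ints[OF this]]
    have "1 + of_nat n - (1 - x - ?z) \<in> \<int>" .
    then show False using ds_c0 that by (simp add: algebra_simps)
  qed
  have "rest_c analytic_on {?z}"
    unfolding rest_c_def[abs_def] using s 1
    by (intro analytic_intros analytic_on_prod_list) auto
  from residue_Gamma_mult[OF this, of c0 1 n]
  have "residue (\<lambda>s. Gamma (c0 + s) * rest_c s) ?z = (-1) ^ n / fact n * rest_c ?z" by simp
  also have "(\<lambda>s. Gamma (c0 + s) * rest_c s) = \<Phi>"
    by (rule ext) (simp add: \<Phi>_def V_def H_def rest_c_def mult_ac)
  finally show ?thesis .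
qed

lemma residue_ds:
  assumes i: "i < length ds"
  shows "residue \<Phi> (1 - ds ! i + of_nat n) = - ((-1) ^ n) / fact n * rest_d i (1 - ds ! i + of_nat n)"
proof -
  let ?z = "1 - ds ! i + of_nat n"
  have di: "ds ! i \<in> set ds" using i by simp
  have "?z \<notin> \<int>"
  proof
    assume "?z \<in> \<int>"
    then have "1 + of_nat n - ?z \<in> \<int>" by (intro Ints_diff Ints_add) auto
    then show False using ds_nonint di by (simp add: algebra_simps)
  qed
  then have s: "sin (of_real pi * ?z) \<noteq> 0" by (rule sin_pi_mult_nonzero)
  have 1: "c0 + ?z \<notin> \<int>\<^sub>\<le>\<^sub>0"
  proof
    assume "c0 + ?z \<in> \<int>\<^sub>\<le>\<^sub>0"
    from Ints_diff[OF Ints_add[OF Ints_1 Ints_of_nat[of n]] nonpos_Ints_imp_Ints[OF this]]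
    have "ds ! i - c0 \<in> \<int>" by (simp add: algebra_simps)
    then show False using ds_c0 di by (simp add: algebra_simps)
  qed
  have 2: "1 - x - ?z \<notin> \<int>\<^sub>\<le>\<^sub>0" if x: "x \<in> set (drop_nth i ds)" for x
  proof
    assume "1 - x - ?z \<in> \<int>\<^sub>\<le>\<^sub>0"
    from Ints_add[OF nonpos_Ints_imp_Ints[OF this] Ints_of_nat[of n]]
    have "(1 - x - ?z) + of_nat n \<in> \<int>" .
    then have "ds ! i - x \<in> \<int>" by (simp add: algebra_simps)
    moreover obtain j where "j < length ds" "j \<noteq> i" "x = ds ! j"
      by (rule in_set_drop_nthE[OF x])
    ultimately show False using ds_ds[of i j] i by auto
  qed
  have "rest_d i analytic_on {?z}"
    unfolding rest_d_def[abs_def] using s 1 2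
    by (intro analytic_intros analytic_on_prod_list) auto
  from residue_Gamma_mult[OF this, of "1 - ds ! i" "-1" n]
  have "residue (\<lambda>s. Gamma (1 - ds ! i - s) * rest_d i s) ?z = - ((-1) ^ n) / fact n * rest_d i ?z" by simp
  also have "(\<lambda>s. Gamma (1 - ds ! i - s) * rest_d i s) = \<Phi>"
    by (rule ext) (simp add: \<Phi>_def V_def H_def rest_d_def mult_ac prod_list_map_drop_nth[OF i])
  finally show ?thesis .
qed

definition P_c :: "complex set" where "P_c = range (\<lambda>n. - c0 - of_nat n)"
definition P_d :: "nat \<Rightarrow> complex set" where "P_d i = range (\<lambda>n. 1 - ds ! i + of_nat n)"
text \<open>The singularities at the integers below \<open>-m\<close> are removable, but division by zero gives \<open>\<Phi>\<close> the
  junk value 0 there, so they have to be excluded as well.\<close>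

definition poles :: "complex set" where "poles = \<int> \<union> P_c \<union> (\<Union>i<length ds. P_d i)"

lemma \<Phi>_holomorphic: "\<Phi> holomorphic_on (- poles)"
proof -
  have "\<Phi> analytic_on {z}" if "z \<in> - poles" for z
  proof -
    have "V analytic_on {z}"
      using that by (intro V_analytic) (auto simp: poles_def P_c_def P_d_def in_set_conv_nth)
    moreover have "sin (of_real pi * z) \<noteq> 0"
      using that by (intro sin_pi_mult_nonzero) (auto simp: poles_def)
    ultimately show ?thesis unfolding \<Phi>_def[abs_def] by (intro analytic_intros) auto
  qed
  then have "\<Phi> analytic_on (- poles)" using analytic_on_analytic_at by blast
  then show ?thesis by (rule analytic_imp_holomorphic)
qed

lemma poles_subset: "poles \<subseteq> (\<Union>x\<in>set (0 # c0 # ds). {p. p + x \<in> \<int>})"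
proof
  fix p assume "p \<in> poles"
  then consider "p \<in> \<int>" | n where "p = - c0 - of_nat n" | i n where "i < length ds" "p = 1 - ds ! i + of_nat n"
    by (auto simp: poles_def P_c_def P_d_def)
  then show "p \<in> (\<Union>x\<in>set (0 # c0 # ds). {p. p + x \<in> \<int>})"
  proof cases
    case 3
    then have "p + ds ! i \<in> \<int>" "ds ! i \<in> set ds" by auto
    then show ?thesis by auto
  qed auto
qed

lemma finite_poles_ball: "finite (poles \<inter> ball 0 r)"
proof (rule finite_subset)
  show "poles \<inter> ball 0 r \<subseteq> (\<Union>x\<in>set (0 # c0 # ds). {p. p + x \<in> \<int>} \<inter> ball 0 r)"
    using poles_subset by blast
  show "finite (\<Union>x\<in>set (0 # c0 # ds). {p. p + x \<in> \<int>} \<inter> ball 0 r)"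
    by (intro finite_UN_I finite_int_translate_ball) auto
qed

end

section \<open>The sum of all residues\<close>

text \<open>A rectangle cuts an index set out of each family of poles that need not be an initial
  segment; absolute convergence makes the sums over any exhausting finite sets converge to the
  series.\<close>

lemma summable_norm_sum_tendsto_suminf:
  fixes f :: "nat \<Rightarrow> 'a::banach"
  assumes "summable (\<lambda>n. norm (f n))" "\<And>N. finite (A N)" "\<And>k. \<forall>\<^sub>F N in sequentially. k \<in> A N"
  shows "(\<lambda>N. sum f (A N)) \<longlonglongrightarrow> suminf f"
proof -
  have "(f has_sum suminf f) UNIV"
    by (rule norm_summable_imp_has_sum[OF assms(1) summable_sums[OF summable_norm_cancel[OF assms(1)]]])
  then have "(sum f \<longlongrightarrow> suminf f) (finite_subsets_at_top UNIV)"
    by (simp add: has_sum_def)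
  moreover have "filterlim A (finite_subsets_at_top UNIV) sequentially"
    unfolding filterlim_finite_subsets_at_top
  proof safe
    fix X :: "nat set" assume X: "finite X"
    then have "\<forall>\<^sub>F N in sequentially. \<forall>k\<in>X. k \<in> A N"
      using assms(3) by (simp add: eventually_ball_finite)
    then show "\<forall>\<^sub>F N in sequentially. finite (A N) \<and> X \<subseteq> A N \<and> A N \<subseteq> UNIV"
      by eventually_elim (use assms(2) in auto)
  qed
  ultimately show ?thesis by (rule filterlim_compose)
qed

text \<open>8 N is the perimeter of the N-th rectangle, and N - 1 bounds |s| from below on
  it.\<close>

lemma tendsto_zero_powr_perimeter:
  fixes \<epsilon> :: real
  assumes "\<epsilon> < -1"
  shows "(\<lambda>N. C * (real N - 1) powr \<epsilon> * (8 * real N)) \<longlonglongrightarrow> 0"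
proof -
  have "(\<lambda>N. (real N - 1) powr \<epsilon> * (8 * real N)) \<longlonglongrightarrow> 0"
    using assms by real_asymp
  from tendsto_mult_left[OF this, of C] show ?thesis by (simp add: mult_ac)
qed

section \<open>Expanding rectangles, the poles inside them and the vanishing of the integral\<close>

context barnes_integrand
begin

text \<open>A square of side 2 N, shifted by \<delta> so that its vertical sides run between the
  poles. The horizontal sides need no such care, because the imaginary parts of the poles are
  bounded.\<close>

definition corner_lo :: "real \<Rightarrow> nat \<Rightarrow> complex" where "corner_lo \<delta> N = Complex (\<delta> - real N) (- real N)"
definition corner_hi :: "real \<Rightarrow> nat \<Rightarrow> complex" where "corner_hi \<delta> N = Complex (\<delta> + real N) (real N)"

lemma corner_le: "Re (corner_lo \<delta> N) \<le> Re (corner_hi \<delta> N)" "Im (corner_lo \<delta> N) \<le> Im (corner_hi \<delta> N)"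
  by (simp_all add: corner_lo_def corner_hi_def)

lemma corner_path_image:
  assumes "s \<in> path_image (rectpath (corner_lo \<delta> N) (corner_hi \<delta> N))" "0 < \<delta>" "\<delta> < 1"
  shows "\<bar>Im s\<bar> = real N \<or> Re s - \<delta> \<in> \<int>" "norm s \<ge> real N - 1"
proof -
  from assms(1) consider "Re s = \<delta> - real N" | "Re s = \<delta> + real N" | "\<bar>Im s\<bar> = real N"
    unfolding path_image_rectpath[OF corner_le] by (auto simp: corner_lo_def corner_hi_def)
  then have "(\<bar>Im s\<bar> = real N \<or> Re s - \<delta> \<in> \<int>) \<and> norm s \<ge> real N - 1"
    using abs_Re_le_cmod[of s] abs_Im_le_cmod[of s] assms(2,3)
    by cases auto
  then show "\<bar>Im s\<bar> = real N \<or> Re s - \<delta> \<in> \<int>" "norm s \<ge> real N - 1" by auto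
qed

lemma eventually_gt_Im: "\<forall>\<^sub>F N in sequentially. \<forall>x\<in>set xs. \<bar>Im x\<bar> < real N"
  by (rule eventually_ball_finite) (auto, real_asymp)

lemma contour_avoids_poles:
  assumes "\<forall>x\<in>set (0 # c0 # ds). \<delta> + Re x \<notin> \<int>" "0 < \<delta>" "\<delta> < 1"
    and "\<forall>x\<in>set (0 # c0 # ds). \<bar>Im x\<bar> < real N"
  shows "poles \<inter> path_image (rectpath (corner_lo \<delta> N) (corner_hi \<delta> N)) = {}"
proof -
  have False if p: "p \<in> poles" "p \<in> path_image (rectpath (corner_lo \<delta> N) (corner_hi \<delta> N))" for p
  proof -
    obtain x where x: "x \<in> set (0 # c0 # ds)" "p + x \<in> \<int>" using poles_subset p(1) by blast
    have "\<bar>Im p\<bar> > \<bar>Im x\<bar> \<or> Re p - \<delta> \<in> \<int>"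
      using corner_path_image[OF p(2) assms(2,3)] assms(4) x(1) by auto
    then have "p + x \<notin> \<int>" by (rule not_Ints_of_contour) (use assms(1) x(1) in blast)
    then show False using x by simp
  qed
  then show ?thesis by blast
qed

lemma contour_integral_tendsto_0:
  assumes \<delta>: "\<forall>x\<in>set (0 # c0 # d0 # ds @ cs). \<delta> + Re x \<notin> \<int>" "0 < \<delta>" "\<delta> < 1"
  shows "(\<lambda>N. contour_integral (rectpath (corner_lo \<delta> N) (corner_hi \<delta> N)) \<Phi>) \<longlonglongrightarrow> 0"
proof -
  obtain C R where CR: "C > 0" "R \<ge> 1" and bound: "\<And>s. norm s \<ge> R \<Longrightarrow> \<bar>Im s\<bar> \<ge> R \<or> Re s - \<delta> \<in> \<int> \<Longrightarrow>
           norm (\<Phi> s) \<le> C * norm s powr \<epsilon>"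
    using \<Phi>_decay[OF \<delta>(1)] by blast
  have "\<forall>\<^sub>F N in sequentially. real N \<ge> R + 1" by real_asymp
  then have "\<forall>\<^sub>F N in sequentially. norm (contour_integral (rectpath (corner_lo \<delta> N) (corner_hi \<delta> N)) \<Phi>)
        \<le> C * (real N - 1) powr \<epsilon> * (8 * real N)"
    using eventually_gt_Im[of "0 # c0 # ds"]
  proof eventually_elim
    case (elim N)
    let ?g = "rectpath (corner_lo \<delta> N) (corner_hi \<delta> N)"
    have avoid: "poles \<inter> path_image ?g = {}"
      using \<delta> elim(2) by (intro contour_avoids_poles) auto
    have "norm (contour_integral ?g \<Phi>) \<le> C * (real N - 1) powr \<epsilon> *
        (2 * (Re (corner_hi \<delta> N) - Re (corner_lo \<delta> N)) + 2 * (Im (corner_hi \<delta> N) - Im (corner_lo \<delta> N)))"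
    proof (rule norm_contour_integral_rectpath_le)
      show "continuous_on (path_image ?g) \<Phi>"
        using \<Phi>_holomorphic avoid
        by (intro holomorphic_on_imp_continuous_on) (auto intro: holomorphic_on_subset)
      fix s assume s: "s \<in> path_image ?g"
      note s' = corner_path_image[OF s \<delta>(2,3)]
      have "norm (\<Phi> s) \<le> C * norm s powr \<epsilon>"
        using s' elim(1) CR by (intro bound) auto
      also have "\<dots> \<le> C * (real N - 1) powr \<epsilon>"
        using s' elim(1) CR \<epsilon>_less by (intro mult_left_mono powr_mono2') auto
      finally show "norm (\<Phi> s) \<le> C * (real N - 1) powr \<epsilon>" .
    qed (use corner_le CR in auto)
    also have "2 * (Re (corner_hi \<delta> N) - Re (corner_lo \<delta> N)) + 2 * (Im (corner_hi \<delta> N) - Im (corner_lo \<delta> N)) = 8 * real N"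
      by (simp add: corner_lo_def corner_hi_def)
    finally show ?case .
  qed
  then show ?thesis
    using tendsto_zero_powr_perimeter[OF \<epsilon>_less] by (rule Lim_null_comparison)
qed

text \<open>A point common to two families would make c0, an entry of \<open>ds\<close>, or a
  difference of such parameters an integer.\<close>

lemma poles_disjoint:
  "\<int> \<inter> P_c = {}" "i < length ds \<Longrightarrow> (\<int> \<union> P_c) \<inter> P_d i = {}"
  "i < length ds \<Longrightarrow> j < length ds \<Longrightarrow> i \<noteq> j \<Longrightarrow> P_d i \<inter> P_d j = {}"
proof -
  show "\<int> \<inter> P_c = {}"
  proof -
    have False if "- c0 - of_nat n \<in> \<int>" for n
      using Ints_minus[OF Ints_add[OF that Ints_of_nat[of n]]] c0_nonint by simp
    then show ?thesis by (auto simp: P_c_def)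
  qed
next
  assume i: "i < length ds"
  then have di: "ds ! i \<in> set ds" by simp
  have "1 - ds ! i + of_nat n \<notin> \<int>" for n
  proof
    assume "1 - ds ! i + of_nat n \<in> \<int>"
    from Ints_diff[OF Ints_add[OF Ints_1 Ints_of_nat[of n]] this]
    have "ds ! i \<in> \<int>" by simp
    then show False using ds_nonint di by blast
  qed
  moreover have "1 - ds ! i + of_nat n \<noteq> - c0 - of_nat k" for n k
  proof
    assume "1 - ds ! i + of_nat n = - c0 - of_nat k"
    then have "ds ! i - c0 = of_nat (1 + n + k)" by (simp add: algebra_simps)
    then show False using ds_c0 di by (metis Ints_of_nat)
  qed
  ultimately show "(\<int> \<union> P_c) \<inter> P_d i = {}" by (fastforce simp: P_d_def P_c_def)
next
  assume ij: "i < length ds" "j < length ds" "i \<noteq> j"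
  have "1 - ds ! i + of_nat n \<noteq> 1 - ds ! j + of_nat k" for n k
  proof
    assume "1 - ds ! i + of_nat n = 1 - ds ! j + of_nat k"
    then have "ds ! i - ds ! j = of_int (int n - int k)" by (simp add: algebra_simps)
    then show False using ds_ds[OF ij] by simp
  qed
  then show "P_d i \<inter> P_d j = {}" by (auto simp: P_d_def)
qed

lemma sum_poles_eq:
  fixes g :: "complex \<Rightarrow> complex"
  assumes fin: "finite (poles \<inter> B)"
  shows "sum g (poles \<inter> B) = (\<Sum>k | of_int k \<in> B. g (of_int k)) + (\<Sum>n | - c0 - of_nat n \<in> B. g (- c0 - of_nat n))
     + (\<Sum>i<length ds. \<Sum>n | 1 - ds ! i + of_nat n \<in> B. g (1 - ds ! i + of_nat n))"
proof -
  have f1: "finite (\<int> \<inter> B)" and f2: "finite (P_c \<inter> B)" and f3: "\<And>i. i < length ds \<Longrightarrow> finite (P_d i \<inter> B)"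
    by (rule finite_subset[OF _ fin], auto simp: poles_def)+
  have "poles \<inter> B = ((\<int> \<inter> B) \<union> (P_c \<inter> B)) \<union> (\<Union>i<length ds. P_d i \<inter> B)"
    by (auto simp: poles_def)
  also have "sum g \<dots> = sum g ((\<int> \<inter> B) \<union> (P_c \<inter> B)) + sum g (\<Union>i<length ds. P_d i \<inter> B)"
  proof (rule sum.union_disjoint)
    show "(\<int> \<inter> B \<union> P_c \<inter> B) \<inter> (\<Union>i<length ds. P_d i \<inter> B) = {}"
      using poles_disjoint(2) by blast
    show "finite (\<int> \<inter> B \<union> P_c \<inter> B)" using f1 f2 by blast
    show "finite (\<Union>i<length ds. P_d i \<inter> B)" by (rule finite_UN_I) (use f3 in auto)
  qed
  also have "sum g ((\<int> \<inter> B) \<union> (P_c \<inter> B)) = sum g (\<int> \<inter> B) + sum g (P_c \<inter> B)"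
    using f1 f2 poles_disjoint(1) by (intro sum.union_disjoint) auto
  also have "sum g (\<Union>i<length ds. P_d i \<inter> B) = (\<Sum>i<length ds. sum g (P_d i \<inter> B))"
  proof (rule sum.UNION_disjoint)
    show "\<forall>i\<in>{..<length ds}. \<forall>j\<in>{..<length ds}. i \<noteq> j \<longrightarrow> P_d i \<inter> B \<inter> (P_d j \<inter> B) = {}"
      using poles_disjoint(3) by blast
  qed (use f3 in auto)
  also have "sum g (\<int> \<inter> B) = (\<Sum>k | of_int k \<in> B. g (of_int k))"
    by (rule sum.reindex_cong[of of_int]) (auto simp: inj_on_def elim!: Ints_cases)
  also have "sum g (P_c \<inter> B) = (\<Sum>n | - c0 - of_nat n \<in> B. g (- c0 - of_nat n))"
    by (rule sum.reindex_cong[of "\<lambda>n. - c0 - of_nat n"]) (auto simp: inj_on_def P_c_def)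
  also have "(\<Sum>i<length ds. sum g (P_d i \<inter> B)) = (\<Sum>i<length ds. \<Sum>n | 1 - ds ! i + of_nat n \<in> B. g (1 - ds ! i + of_nat n))"
  proof (rule sum.cong[OF refl])
    fix i
    show "sum g (P_d i \<inter> B) = (\<Sum>n | 1 - ds ! i + of_nat n \<in> B. g (1 - ds ! i + of_nat n))"
      by (rule sum.reindex_cong[of "\<lambda>n. 1 - ds ! i + of_nat n"]) (auto simp: inj_on_def P_d_def)
  qed
  finally show ?thesis .
qed

lemma eventually_in_rectangle: "\<forall>\<^sub>F N in sequentially. z \<in> box (corner_lo \<delta> N) (corner_hi \<delta> N)"
proof -
  have "\<forall>\<^sub>F N in sequentially. real N > \<bar>Re z\<bar> + \<bar>\<delta>\<bar> + \<bar>Im z\<bar>" by real_asymp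
  then show ?thesis
    by eventually_elim (auto simp: in_box_complex_iff corner_lo_def corner_hi_def)
qed

lemma finite_translates_in_rectangle:
  assumes "inj f" "range f \<subseteq> poles"
  shows "finite {n::nat. f n \<in> box (corner_lo \<delta> N) (corner_hi \<delta> N)}"
proof -
  have "finite (poles \<inter> box (corner_lo \<delta> N) (corner_hi \<delta> N))"
    using finite_poles_ball bounded_subset_ballD[OF bounded_box] by (metis Int_mono finite_subset order_refl)
  then have "finite (f -` (poles \<inter> box (corner_lo \<delta> N) (corner_hi \<delta> N)))"
    using assms(1) by (rule finite_vimageI)
  then show ?thesis by (rule finite_subset[rotated]) (use assms(2) in auto)
qed

text \<open>Since 0 < \<delta> < 1, the shift to the right takes in N but loses -N.\<close>

lemma ints_in_rectangle:
  assumes "0 < \<delta>" "\<delta> < 1" "N \<ge> 1"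
  shows "{k. of_int k \<in> box (corner_lo \<delta> N) (corner_hi \<delta> N)} = {- int N + 1..int N}"
proof -
  have "of_int k \<in> box (corner_lo \<delta> N) (corner_hi \<delta> N) \<longleftrightarrow> k \<in> {- int N + 1..int N}" for k
  proof -
    have "of_int k \<in> box (corner_lo \<delta> N) (corner_hi \<delta> N) \<longleftrightarrow> \<delta> - real N < of_int k \<and> of_int k < \<delta> + real N"
      using assms(3) by (simp add: in_box_complex_iff corner_lo_def corner_hi_def)
    also have "\<dots> \<longleftrightarrow> k \<in> {- int N + 1..int N}" using assms(1,2) by (auto; linarith)
    finally show ?thesis .
  qed
  then show ?thesis by blast
qed

end

lemma sum_int_interval_split:
  fixes f :: "int \<Rightarrow> complex"
  assumes "N \<ge> 1"
  shows "(\<Sum>k=- int N + 1..int N. f k) = (\<Sum>n<Suc N. f (int n)) + (\<Sum>k=1..<N. f (- int k))"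
proof -
  have "{- int N + 1..int N} = int ` {..<Suc N} \<union> (\<lambda>k. - int k) ` {1..<N}"
  proof safe
    fix k :: int assume k: "k \<in> {- int N + 1..int N}" "k \<notin> (\<lambda>k. - int k) ` {1..<N}"
    have "k \<ge> 0"
    proof (rule ccontr)
      assume "\<not> k \<ge> 0"
      then have "k = - int (nat (- k))" "nat (- k) \<in> {1..<N}" using k by auto
      then show False using k(2) by blast
    qed
    then have "k = int (nat k)" "nat k \<in> {..<Suc N}" using k by auto
    then show "k \<in> int ` {..<Suc N}" by blast
  qed (use assms in auto)
  also have "sum f \<dots> = sum f (int ` {..<Suc N}) + sum f ((\<lambda>k. - int k) ` {1..<N})"
    by (intro sum.union_disjoint) auto
  finally show ?thesis by (simp add: sum.reindex inj_on_def del: sum.lessThan_Suc)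
qed

section \<open>Derivatives of the regular numerator at the integers\<close>

lemma prod_list_rGamma_has_field_derivative:
  assumes "\<forall>x\<in>set xs. 1 - x - z \<notin> \<int>\<^sub>\<le>\<^sub>0"
  shows "((\<lambda>s. prod_list (map (\<lambda>x. rGamma (1 - x - s)) xs)) has_field_derivative
      prod_list (map (\<lambda>x. rGamma (1 - x - z)) xs) * sum_list (map (\<lambda>x. Digamma (1 - x - z)) xs)) (at (z::complex))"
  using assms
proof (induction xs)
  case (Cons x xs)
  \<comment> \<open>The sign is positive: the minus of rGamma' = - rGamma psi meets the inner
    derivative -1.\<close>
  have "((\<lambda>s. rGamma (1 - x - s)) has_field_derivative (rGamma (1 - x - z) * Digamma (1 - x - z))) (at z)"
    using Cons.prems by (auto intro!: derivative_eq_intros)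
  from DERIV_mult[OF this Cons.IH] Cons.prems show ?case by (simp add: algebra_simps)
qed simp

lemma prod_list_Gamma_has_field_derivative:
  assumes "\<forall>x\<in>set xs. 1 - x - z \<notin> \<int>\<^sub>\<le>\<^sub>0"
  shows "((\<lambda>s. prod_list (map (\<lambda>x. Gamma (1 - x - s)) xs)) has_field_derivative
      - (prod_list (map (\<lambda>x. Gamma (1 - x - z)) xs) * sum_list (map (\<lambda>x. Digamma (1 - x - z)) xs))) (at (z::complex))"
  using assms
proof (induction xs)
  case (Cons x xs)
  have "((\<lambda>s. Gamma (1 - x - s)) has_field_derivative - (Gamma (1 - x - z) * Digamma (1 - x - z))) (at z)"
    using Cons.prems by (auto intro!: derivative_eq_intros)
  from DERIV_mult[OF this Cons.IH] Cons.prems show ?case by (simp add: algebra_simps)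
qed simp

lemma one_plus_of_nat_not_nonpos_Ints: "1 + of_nat k \<notin> (\<int>\<^sub>\<le>\<^sub>0 :: complex set)"
proof
  assume "1 + of_nat k \<in> (\<int>\<^sub>\<le>\<^sub>0 :: complex set)"
  then obtain j where j: "1 + of_nat k = - (of_nat j :: complex)" by (elim nonpos_Ints_cases')
  have "of_nat (1 + k + j) = (1 + of_nat k) + (of_nat j :: complex)" by simp
  also have "\<dots> = 0" unfolding j by simp
  finally show False by (simp only: of_nat_eq_0_iff)
qed

lemma nonint_shift:
  fixes x :: complex
  assumes "x \<notin> \<int>"
  shows "x + of_int n \<notin> \<int>\<^sub>\<le>\<^sub>0" "1 - x - of_int n \<notin> \<int>\<^sub>\<le>\<^sub>0"
proof -
  show "x + of_int n \<notin> \<int>\<^sub>\<le>\<^sub>0"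
  proof
    assume "x + of_int n \<in> \<int>\<^sub>\<le>\<^sub>0"
    from Ints_diff[OF nonpos_Ints_imp_Ints[OF this] Ints_of_int[of n]] show False using assms by simp
  qed
  show "1 - x - of_int n \<notin> \<int>\<^sub>\<le>\<^sub>0"
  proof
    assume "1 - x - of_int n \<in> \<int>\<^sub>\<le>\<^sub>0"
    from Ints_diff[OF Ints_diff[OF Ints_1 Ints_of_int[of n]] nonpos_Ints_imp_Ints[OF this]]
    show False using assms by simp
  qed
qed

lemma rGamma_shift_has_field_derivative:
  "(rGamma has_field_derivative D) (at (a + z)) \<Longrightarrow> ((\<lambda>s. rGamma (a + s)) has_field_derivative D) (at (z::complex))"
  by (simp add: add.commute[of a] DERIV_shift)

context barnes_integrand
begin

text \<open>The logarithmic derivative of \<open>H\<close>; the arguments 1 - x - z reverse the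
  usual signs for \<open>cs\<close> and \<open>ds\<close>.\<close>

definition \<Psi> :: "complex \<Rightarrow> complex" where
  "\<Psi> z = Digamma (c0 + z) - Digamma (d0 + z) + sum_list (map (\<lambda>x. Digamma (1 - x - z)) cs)
         - sum_list (map (\<lambda>x. Digamma (1 - x - z)) ds)"

lemma H_has_field_derivative: "(H has_field_derivative H (of_int n) * \<Psi> (of_int n)) (at (of_int n))"
proof -
  let ?z = "of_int n :: complex"
  have 1: "((\<lambda>s. Gamma (c0 + s)) has_field_derivative Gamma (c0 + ?z) * Digamma (c0 + ?z)) (at ?z)"
    using nonint_shift(1)[OF c0_nonint] by (auto intro!: derivative_eq_intros)
  have 2: "((\<lambda>s. rGamma (d0 + s)) has_field_derivative - rGamma (d0 + ?z) * Digamma (d0 + ?z)) (at ?z)"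
    using nonint_shift(1)[OF d0_nonint] by (auto intro!: derivative_eq_intros)
  have 3: "\<forall>x\<in>set cs. 1 - x - ?z \<notin> \<int>\<^sub>\<le>\<^sub>0" "\<forall>x\<in>set ds. 1 - x - ?z \<notin> \<int>\<^sub>\<le>\<^sub>0"
    using nonint_shift(2) cs_nonint ds_nonint by auto
  show ?thesis
    unfolding H_def[abs_def]
    by (rule DERIV_cong[OF DERIV_mult[OF DERIV_mult[OF DERIV_mult[OF 1 2]
          prod_list_rGamma_has_field_derivative[OF 3(1)]] prod_list_Gamma_has_field_derivative[OF 3(2)]]])
       (simp add: \<Psi>_def algebra_simps)
qed

lemma deriv_V_nonneg:
  "deriv V (of_nat n) = V (of_nat n) *
     (\<Psi> (of_nat n) - Digamma (1 + of_nat m + of_nat n) - Digamma (1 + of_nat n))"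
proof (rule DERIV_imp_deriv)
  let ?z = "of_nat n :: complex"
  have H: "(H has_field_derivative H ?z * \<Psi> ?z) (at ?z)"
    using H_has_field_derivative[of "int n"] by simp
  have "1 + of_nat k + ?z \<notin> \<int>\<^sub>\<le>\<^sub>0" for k
    using one_plus_of_nat_not_nonpos_Ints[of "k + n"] by (simp add: add.assoc)
  from this[of m] this[of 0] have
    1: "((\<lambda>s. rGamma (1 + of_nat m + s)) has_field_derivative - rGamma (1 + of_nat m + ?z) * Digamma (1 + of_nat m + ?z)) (at ?z)"
    and 2: "((\<lambda>s. rGamma (1 + s)) has_field_derivative - rGamma (1 + ?z) * Digamma (1 + ?z)) (at ?z)"
    by (auto intro!: derivative_eq_intros)
  show "(V has_field_derivative V ?z * (\<Psi> ?z - Digamma (1 + of_nat m + ?z) - Digamma (1 + ?z))) (at ?z)"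
    unfolding V_def[abs_def]
    by (rule DERIV_cong[OF DERIV_mult[OF H DERIV_mult[OF 1 2]]]) (simp add: algebra_simps)
qed

text \<open>Since \<open>rGamma (1 + s)\<close> vanishes at -(k + 1), the product rule leaves only
  the term with its derivative, the value (-1)^k k! of rGamma' at -k.\<close>

lemma deriv_V_neg:
  "deriv V (- of_nat (Suc k)) = H (- of_nat (Suc k)) * rGamma (of_nat m - of_nat k) * ((-1) ^ k * fact k)"
proof (rule DERIV_imp_deriv)
  let ?z = "- of_nat (Suc k) :: complex"
  have H: "(H has_field_derivative H ?z * \<Psi> ?z) (at ?z)"
    using H_has_field_derivative[of "- int (Suc k)"] by simp
  have 1: "((\<lambda>s. rGamma (1 + of_nat m + s)) has_field_derivative deriv rGamma (1 + of_nat m + ?z)) (at ?z)"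
  proof -
    have "(rGamma has_field_derivative deriv rGamma (1 + of_nat m + ?z)) (at (1 + of_nat m + ?z))"
      using field_differentiable_rGamma DERIV_deriv_iff_field_differentiable by blast
    then show ?thesis by (rule rGamma_shift_has_field_derivative)
  qed
  have 2: "((\<lambda>s. rGamma (1 + s)) has_field_derivative ((-1) ^ k * fact k)) (at ?z)"
  proof -
    have "(rGamma has_field_derivative ((-1) ^ k * fact k)) (at (1 + ?z))"
      using has_field_derivative_rGamma_nonpos_int[of k UNIV] by simp
    then show ?thesis by (rule rGamma_shift_has_field_derivative)
  qed
  have 3: "rGamma (1 + ?z) = 0" by (simp add: rGamma_eq_zero_iff)
  show "(V has_field_derivative H ?z * rGamma (of_nat m - of_nat k) * ((-1) ^ k * fact k)) (at ?z)"
    unfolding V_def[abs_def]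
    by (rule DERIV_cong[OF DERIV_mult[OF H DERIV_mult[OF 1 2]]])
       (use 3 in \<open>simp add: algebra_simps\<close>)
qed

text \<open>Left of -m both reciprocal Gammas vanish, so \<open>V\<close> has at least a double zero
  and absorbs the double zero of the squared sine.\<close>

lemma deriv_V_eq_0: "k > m \<Longrightarrow> deriv V (- of_nat k) = 0"
proof -
  assume k: "k > m"
  then obtain j where j: "k = Suc (m + j)" by (metis less_iff_Suc_add)
  have "rGamma (of_nat m - of_nat (m + j) :: complex) = 0" by (simp add: rGamma_eq_zero_iff)
  then show ?thesis unfolding j using deriv_V_neg[of "m + j"] by simp
qed

text \<open>The residues inside the N-th rectangle have total tending to 0. Subtracting the
  convergent contributions of the other families leaves the partial sums of the series at the
  nonnegative integers, which therefore converge.\<close>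

theorem deriv_V_sums:
  assumes sc: "summable (\<lambda>n. norm (residue \<Phi> (- c0 - of_nat n)))"
    and sd: "\<And>i. i < length ds \<Longrightarrow> summable (\<lambda>n. norm (residue \<Phi> (1 - ds ! i + of_nat n)))"
  shows "(\<lambda>n. deriv V (of_nat n)) sums
     (- (\<Sum>k=1..m. deriv V (- of_nat k)) - of_real pi ^ 2 * ((\<Sum>n. residue \<Phi> (- c0 - of_nat n))
         + (\<Sum>i<length ds. \<Sum>n. residue \<Phi> (1 - ds ! i + of_nat n))))"
proof -
  obtain \<delta> where \<delta>: "0 < \<delta>" "\<delta> < 1" "\<forall>x\<in>set (0 # c0 # d0 # ds @ cs). \<delta> + Re x \<notin> \<int>"
    using exists_avoiding_offset[of "set (0 # c0 # d0 # ds @ cs)"] by (metis List.finite_set)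
  let ?B = "\<lambda>N. box (corner_lo \<delta> N) (corner_hi \<delta> N)"
  let ?g = "\<lambda>N. rectpath (corner_lo \<delta> N) (corner_hi \<delta> N)"
  let ?r = "residue \<Phi>"
  define Sc where "Sc = (\<lambda>N. \<Sum>n | - c0 - of_nat n \<in> ?B N. ?r (- c0 - of_nat n))"
  define Sd where "Sd = (\<lambda>i N. \<Sum>n | 1 - ds ! i + of_nat n \<in> ?B N. ?r (1 - ds ! i + of_nat n))"
  have finB: "finite (poles \<inter> ?B N)" for N
    using finite_poles_ball bounded_subset_ballD[OF bounded_box] by (metis Int_mono finite_subset order_refl)
  have ci: "\<forall>\<^sub>F N in sequentially. contour_integral (?g N) \<Phi> / (2 * of_real pi * \<i>) = (\<Sum>p\<in>poles \<inter> ?B N. ?r p)"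
    using eventually_gt_Im[of "0 # c0 # ds"]
  proof eventually_elim
    case (elim N)
    have "poles \<inter> path_image (?g N) = {}" using \<delta> elim by (intro contour_avoids_poles) auto
    then show ?case
      using contour_integral_rectpath_residues[OF \<Phi>_holomorphic finite_poles_ball corner_le] by simp
  qed
  have "(\<lambda>N. contour_integral (?g N) \<Phi> / (2 * of_real pi * \<i>)) \<longlonglongrightarrow> 0 / (2 * of_real pi * \<i>)"
    using \<delta> by (intro tendsto_divide contour_integral_tendsto_0) auto
  from Lim_transform_eventually[OF this ci]
  have total: "(\<lambda>N. \<Sum>p\<in>poles \<inter> ?B N. ?r p) \<longlonglongrightarrow> 0" by simp
  have Sc: "Sc \<longlonglongrightarrow> (\<Sum>n. ?r (- c0 - of_nat n))"
    unfolding Sc_def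
  proof (rule summable_norm_sum_tendsto_suminf[OF sc])
    show "finite {n. - c0 - of_nat n \<in> ?B N}" for N
      by (rule finite_translates_in_rectangle) (auto simp: inj_on_def poles_def P_c_def)
  qed (use eventually_in_rectangle in auto)
  have Sd: "Sd i \<longlonglongrightarrow> (\<Sum>n. ?r (1 - ds ! i + of_nat n))" if "i < length ds" for i
    unfolding Sd_def
  proof (rule summable_norm_sum_tendsto_suminf[OF sd[OF that]])
    show "finite {n. 1 - ds ! i + of_nat n \<in> ?B N}" for N
      using that by (intro finite_translates_in_rectangle) (auto simp: inj_on_def poles_def P_d_def)
  qed (use eventually_in_rectangle in auto)
  have "\<forall>\<^sub>F N in sequentially. N > m" by (rule eventually_gt_at_top)
  \<comment> \<open>The rectangle contains the integers from -N + 1 to N, so N > m ensures that all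
    of -m, ..., -1 lie inside.\<close>
  then have ev: "\<forall>\<^sub>F N in sequentially.
     of_real pi ^ 2 * ((\<Sum>p\<in>poles \<inter> ?B N. ?r p) - (Sc N + (\<Sum>i<length ds. Sd i N))) - (\<Sum>k=1..m. deriv V (- of_nat k))
        = (\<Sum>n<Suc N. deriv V (of_nat n))"
  proof eventually_elim
    case (elim N)
    have "(\<Sum>p\<in>poles \<inter> ?B N. ?r p) - (Sc N + (\<Sum>i<length ds. Sd i N)) = (\<Sum>k | of_int k \<in> ?B N. ?r (of_int k))"
      unfolding sum_poles_eq[OF finB] Sc_def Sd_def by simp
    also have "\<dots> = (\<Sum>k=- int N + 1..int N. deriv V (of_int k) / of_real pi ^ 2)"
      using ints_in_rectangle[OF \<delta>(1,2), of N] elim by (simp add: residue_int)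
    also have "\<dots> = (\<Sum>k=- int N + 1..int N. deriv V (of_int k)) / of_real pi ^ 2"
      by (simp add: sum_divide_distrib)
    finally have "of_real pi ^ 2 * ((\<Sum>p\<in>poles \<inter> ?B N. ?r p) - (Sc N + (\<Sum>i<length ds. Sd i N)))
        = (\<Sum>k=- int N + 1..int N. deriv V (of_int k))" by simp
    also have "\<dots> = (\<Sum>n<Suc N. deriv V (of_nat n)) + (\<Sum>k=1..<N. deriv V (- of_nat k))"
      using elim by (subst sum_int_interval_split) (simp_all del: sum.lessThan_Suc)
    also have "(\<Sum>k=1..<N. deriv V (- of_nat k)) = (\<Sum>k=1..m. deriv V (- of_nat k))"
      by (rule sum.mono_neutral_right) (use elim deriv_V_eq_0 in auto)
    finally show ?case by simp
  qed
  have "(\<lambda>N. of_real pi ^ 2 * ((\<Sum>p\<in>poles \<inter> ?B N. ?r p) - (Sc N + (\<Sum>i<length ds. Sd i N))) - (\<Sum>k=1..m. deriv V (- of_nat k)))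
     \<longlonglongrightarrow> of_real pi ^ 2 * (0 - ((\<Sum>n. ?r (- c0 - of_nat n)) + (\<Sum>i<length ds. \<Sum>n. ?r (1 - ds ! i + of_nat n)))) - (\<Sum>k=1..m. deriv V (- of_nat k))"
    by (intro tendsto_intros total Sc Sd) auto
  from Lim_transform_eventually[OF this ev]
  have "(\<lambda>N. \<Sum>n<Suc N. deriv V (of_nat n)) \<longlonglongrightarrow>
    (- (\<Sum>k=1..m. deriv V (- of_nat k)) - of_real pi ^ 2 * ((\<Sum>n. ?r (- c0 - of_nat n))
         + (\<Sum>i<length ds. \<Sum>n. ?r (1 - ds ! i + of_nat n))))"
    by (simp only: diff_0 mult_minus_right minus_diff_commute)
  then show ?thesis unfolding sums_def by (rule filterlim_sequentially_Suc[THEN iffD1])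
qed

end

section \<open>Identification of the hypergeometric terms\<close>

lemma rGamma_minus_of_nat: "rGamma (z - of_nat n) = (-1) ^ n * pochhammer (1 - z) n * rGamma (z::complex)"
  using pochhammer_rGamma[of "z - of_nat n" n] pochhammer_minus'[of "z - 1" n] by simp

lemma Gamma_minus_of_nat: "Gamma (z - of_nat n) = (-1) ^ n * Gamma z / pochhammer (1 - z :: complex) n"
  unfolding Gamma_def rGamma_minus_of_nat by (cases "even n") (simp_all add: field_simps)

lemma pochhammer_neq_0: "z \<notin> \<int>\<^sub>\<le>\<^sub>0 \<Longrightarrow> pochhammer (z::complex) n \<noteq> 0"
  using pochhammer_eq_0_imp_nonpos_Int by blast

lemma Gamma_plus_of_nat: "z \<notin> \<int>\<^sub>\<le>\<^sub>0 \<Longrightarrow> Gamma (z + of_nat n) = pochhammer z n * Gamma (z::complex)"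
  by (simp add: pochhammer_Gamma Gamma_eq_zero_iff)

lemma rGamma_plus_of_nat: "z \<notin> \<int>\<^sub>\<le>\<^sub>0 \<Longrightarrow> rGamma (z + of_nat n) = rGamma (z::complex) / pochhammer z n"
  using pochhammer_rGamma[of z n] by (simp add: pochhammer_neq_0)

text \<open>Dividing by \<open>Gamma_vec\<close> is right even at a pole: there Gamma is 0 by
  convention, and division by 0 gives the true value 0 of 1/Gamma. This matters for the entries e -
  x with e in \<open>ds\<close> and x in \<open>cs\<close>, which may be nonpositive
  integers.\<close>

lemma prod_list_rGamma_minus_of_nat:
  "prod_list (map (\<lambda>z. rGamma (z - of_nat n)) zs)
     = (-1) ^ (n * length zs) * poch_vec (map (\<lambda>z. 1 - z) zs) n / Gamma_vec zs"
proof (induction zs)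
  case (Cons z zs)
  have "rGamma (z - of_nat n) = (-1) ^ n * pochhammer (1 - z) n / Gamma z"
    unfolding rGamma_minus_of_nat by (simp add: rGamma_inverse_Gamma divide_inverse)
  with Cons show ?case
    unfolding Gamma_vec_def poch_vec_def by (simp add: power_add mult_ac)
qed (simp add: Gamma_vec_def poch_vec_def)

lemma prod_list_Gamma_minus_of_nat:
  "prod_list (map (\<lambda>z. Gamma (z - of_nat n)) zs)
     = (-1) ^ (n * length zs) * Gamma_vec zs / poch_vec (map (\<lambda>z. 1 - z) zs) n"
  unfolding Gamma_vec_def poch_vec_def
  by (induction zs) (auto simp: Gamma_minus_of_nat power_add field_simps)

lemma prod_list_Gamma_plus_of_nat:
  "\<forall>z\<in>set zs. z \<notin> \<int>\<^sub>\<le>\<^sub>0 \<Longrightarrow>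
     prod_list (map (\<lambda>z. Gamma (z + of_nat n)) zs) = poch_vec zs n * Gamma_vec zs"
  unfolding Gamma_vec_def poch_vec_def
  by (induction zs) (auto simp: Gamma_plus_of_nat)

lemma prod_list_rGamma_plus_of_nat:
  "\<forall>z\<in>set zs. z \<notin> \<int>\<^sub>\<le>\<^sub>0 \<Longrightarrow>
     prod_list (map (\<lambda>z. rGamma (z + of_nat n)) zs) = 1 / (poch_vec zs n * Gamma_vec zs)"
proof (induction zs)
  case (Cons z zs)
  have "rGamma (z + of_nat n) = 1 / (pochhammer z n * Gamma z)"
    using Cons.prems rGamma_plus_of_nat[of z n] by (simp add: rGamma_inverse_Gamma[of z] divide_inverse)
  with Cons show ?case
    unfolding Gamma_vec_def poch_vec_def by (simp add: mult_ac)
qed (simp add: Gamma_vec_def poch_vec_def)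

lemma poch_vec_Cons [simp]: "poch_vec (x # xs) n = pochhammer x n * poch_vec xs n"
  by (simp add: poch_vec_def)

lemma poch_vec_Nil [simp]: "poch_vec [] n = 1"
  by (simp add: poch_vec_def)

lemma Gamma_vec_Cons [simp]: "Gamma_vec (x # xs) = Gamma x * Gamma_vec xs"
  by (simp add: Gamma_vec_def)

lemma Gamma_vec_neq_0: "\<forall>z\<in>set zs. z \<notin> \<int>\<^sub>\<le>\<^sub>0 \<Longrightarrow> Gamma_vec zs \<noteq> 0"
  unfolding Gamma_vec_def by (induction zs) (auto simp: Gamma_eq_zero_iff)

text \<open>Origin of the prefactor (1 - d)_1/(1 - c)_1 and of the parameters 2 - d, 2 - c in the
  finite sum.\<close>

lemma poch_vec_Suc: "poch_vec (map (\<lambda>x. 1 - x) xs) (Suc k)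
    = poch_vec (map (\<lambda>x. 1 - x) xs) 1 * poch_vec (map (\<lambda>x. 2 - x) xs) k"
proof (induction xs)
  case (Cons x xs)
  have "1 - x + 1 = 2 - x" by simp
  then have "pochhammer (1 - x) (Suc k) = (1 - x) * pochhammer (2 - x) k"
    by (simp only: pochhammer_rec)
  with Cons show ?case by simp
qed simp

text \<open>The n-th term is O(n^(Re(sum as - sum bs) - 1)): n! counts as one more denominator
  Gamma, with parameter 1. Terminating series are split off because Gamma would have a pole at an
  upper parameter; they can occur among the series attached to \<open>ds\<close>, whose upper
  parameters 1 + x - e with x in \<open>cs\<close> may be nonpositive integers.\<close>

lemma summable_norm_hyp_coeff:
  assumes len: "length as = length bs + 1" and bs: "\<forall>b\<in>set bs. b \<notin> \<int>\<^sub>\<le>\<^sub>0"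
    and Re: "Re (sum_list bs - sum_list as) > 0"
  shows "summable (\<lambda>n. norm (poch_vec as n / poch_vec bs n * 1 ^ n / of_nat (fact n)))"
proof (cases "\<exists>a\<in>set as. a \<in> \<int>\<^sub>\<le>\<^sub>0")
  case True
  then obtain a k where a: "a \<in> set as" "a = - of_nat k" by (auto elim: nonpos_Ints_cases')
  have "poch_vec as n = 0" if "n \<notin> {..k}" for n
  proof -
    have "pochhammer a n = 0" using a(2) that by (simp add: pochhammer_of_nat_eq_0_iff)
    then show ?thesis using a(1) unfolding poch_vec_def by (force simp: prod_list_zero_iff)
  qed
  then show ?thesis by (intro summable_finite[of "{..k}"]) auto
next
  case False
  define K where "K = Gamma_vec bs / Gamma_vec as"
  define e where "e = Re (sum_list as - sum_list (1 # bs))"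
  have e: "e < -1" using Re by (simp add: e_def)
  obtain C R where CR: "C > 0" "R \<ge> 1" and bound: "\<And>s. Re s \<ge> 0 \<Longrightarrow> norm s \<ge> R \<Longrightarrow>
      norm (prod_list (map (\<lambda>a. Gamma (s + a)) as) * prod_list (map (\<lambda>b. rGamma (s + b)) (1 # bs)))
             \<le> C * norm s powr e"
    using norm_Gamma_prod_ratio_le[of as "1 # bs"] len unfolding e_def by auto
  have eq: "poch_vec as n / poch_vec bs n * 1 ^ n / of_nat (fact n) =
      K * (prod_list (map (\<lambda>a. Gamma (of_nat n + a)) as) * prod_list (map (\<lambda>b. rGamma (of_nat n + b)) (1 # bs)))" for n
  proof -
    have 1: "prod_list (map (\<lambda>a. Gamma (of_nat n + a)) as) = poch_vec as n * Gamma_vec as"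
      using prod_list_Gamma_plus_of_nat[of as n] False by (simp add: add.commute)
    have 2: "prod_list (map (\<lambda>b. rGamma (of_nat n + b)) bs) = 1 / (poch_vec bs n * Gamma_vec bs)"
      using prod_list_rGamma_plus_of_nat[of bs n] bs by (simp add: add.commute)
    have 3: "rGamma (of_nat n + 1) = 1 / (of_nat (fact n) :: complex)"
      using Gamma_fact[of n, where ?'a = complex] by (simp add: rGamma_inverse_Gamma field_simps add.commute)
    show ?thesis unfolding K_def
      using Gamma_vec_neq_0[of as] Gamma_vec_neq_0[of bs] False bs
      by (simp add: 1 2 3[simplified])
  qed
  have "\<forall>\<^sub>F n in sequentially. norm (norm (poch_vec as n / poch_vec bs n * 1 ^ n / of_nat (fact n))) \<le> norm K * C * real n powr e"
  proof -
    have "\<forall>\<^sub>F n in sequentially. real n \<ge> R" by real_asymp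
    then show ?thesis
    proof eventually_elim
      case (elim n)
      have "norm (poch_vec as n / poch_vec bs n * 1 ^ n / of_nat (fact n)) \<le> norm K * (C * real n powr e)"
        unfolding eq norm_mult[of K] using bound[of "of_nat n"] elim by (intro mult_left_mono) auto
      then show ?case by (simp add: mult.assoc)
    qed
  qed
  moreover have "summable (\<lambda>n. norm K * C * real n powr e)"
    using e by (intro summable_mult) (simp add: summable_real_powr_iff)
  ultimately show ?thesis by (rule summable_comparison_test_ev)
qed

text \<open>Obtained by differentiating rGamma(z) rGamma(1 - z) = sin(pi z)/pi in two ways.\<close>

lemma Digamma_reflection:
  fixes z :: complex
  assumes z: "z \<notin> \<int>"
  shows "Digamma (1 - z) = Digamma z + of_real pi * cot (of_real pi * z)"
proof -
  have z1: "z \<notin> \<int>\<^sub>\<le>\<^sub>0" using z nonpos_Ints_imp_Ints by blast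
  have z2: "1 - z \<notin> \<int>\<^sub>\<le>\<^sub>0" using Ints_diff[OF Ints_1 nonpos_Ints_imp_Ints[of "1 - z"]] z by auto
  have "((\<lambda>z. rGamma z * rGamma (1 - z)) has_field_derivative
      rGamma z * rGamma (1 - z) * (Digamma (1 - z) - Digamma z)) (at z)"
    using z1 z2 by (auto intro!: derivative_eq_intros simp: algebra_simps)
  moreover have "((\<lambda>z. rGamma z * rGamma (1 - z)) has_field_derivative cos (of_real pi * z)) (at z)"
    unfolding rGamma_reflection_complex by (auto intro!: derivative_eq_intros)
  ultimately have "rGamma z * rGamma (1 - z) * (Digamma (1 - z) - Digamma z) = cos (of_real pi * z)"
    by (rule DERIV_unique)
  then have "sin (of_real pi * z) * (Digamma (1 - z) - Digamma z) = of_real pi * cos (of_real pi * z)"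
    unfolding rGamma_reflection_complex by (simp add: field_simps)
  moreover have "sin (of_real pi * z) \<noteq> 0" by (rule sin_pi_mult_nonzero[OF z])
  ultimately show ?thesis by (simp add: cot_def field_simps)
qed

lemma sin_cos_pi_of_nat: "sin (of_real pi * of_nat n :: complex) = 0" "cos (of_real pi * of_nat n :: complex) = (-1) ^ n"
  using arg_cong[OF sin_npi2[of n], of complex_of_real] arg_cong[OF cos_npi2[of n], of complex_of_real]
  by (simp_all del: sin_npi2 cos_npi2 flip: sin_of_real cos_of_real)

lemma sin_pi_plus_of_nat: "sin (of_real pi * (z + of_nat n)) = (-1) ^ n * sin (of_real pi * z :: complex)"
  by (simp add: distrib_left sin_add sin_cos_pi_of_nat)

lemma sin_pi_minus_of_nat: "sin (of_real pi * (z - of_nat n)) = (-1) ^ n * sin (of_real pi * z :: complex)"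
  by (simp add: right_diff_distrib sin_diff sin_cos_pi_of_nat)

lemma cot_pi_plus_of_nat: "cot (of_real pi * (z + of_nat n)) = cot (of_real pi * z :: complex)"
  by (simp add: distrib_left sin_add cos_add sin_cos_pi_of_nat cot_def)

text \<open>Reflection at e - m - 1 followed by one step of the functional equation; this produces
  the factors Gamma(d_k - m)/(d_k - m - 1) of the last sum and, with m = 0, Gamma(d_k)/(d_k -
  1).\<close>

lemma rGamma_two_plus:
  fixes e :: complex
  assumes "e \<notin> \<int>"
  shows "rGamma (2 - e + of_nat m) = - ((-1) ^ m) * Gamma (e - of_nat m) / (e - of_nat m - 1) * (sin (of_real pi * e) / of_real pi)"
proof -
  let ?z = "e - of_nat (Suc m)"
  have z: "?z \<notin> \<int>" using Ints_add[of ?z "of_nat (Suc m)"] assms by auto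
  then have z': "?z \<notin> \<int>\<^sub>\<le>\<^sub>0" "?z \<noteq> 0" using nonpos_Ints_imp_Ints by auto
  have "rGamma (2 - e + of_nat m) = rGamma (1 - ?z)" by (simp add: algebra_simps)
  also have "\<dots> = Gamma ?z * (sin (of_real pi * ?z) / of_real pi)" by (rule rGamma_one_minus[OF z])
  also have "sin (of_real pi * ?z) = - ((-1) ^ m) * sin (of_real pi * e)"
    unfolding sin_pi_minus_of_nat by simp
  also have "Gamma ?z = Gamma (e - of_nat m) / (e - of_nat m - 1)"
  proof -
    have 1: "?z + 1 = e - of_nat m" and 2: "?z = e - of_nat m - 1" by simp_all
    have "Gamma (e - of_nat m) = ?z * Gamma ?z" using Gamma_plus1[OF z'(1)] unfolding 1 .
    then show ?thesis using z'(2) unfolding 2 by simp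
  qed
  finally show ?thesis by simp
qed

section \<open>The residues rewritten as the terms of the identity\<close>

context barnes_integrand
begin

abbreviation c where "c \<equiv> c0 # cs"
abbreviation d where "d \<equiv> d0 # ds"

definition base_coeff :: "nat \<Rightarrow> complex" where
  "base_coeff n = poch_vec c n / (poch_vec d n * of_nat (fact (m + n)) * of_nat (fact n))"

definition cot_sum :: complex where
  "cot_sum = sum_list (map (\<lambda>x. cot (of_real pi * x)) cs) - sum_list (map (\<lambda>x. cot (of_real pi * x)) ds)"

text \<open>\<open>H0\<close> is the value \<open>H 0\<close>, the factor between the residue sum and the identity to be proved.\<close>

definition H0 :: complex where
  "H0 = Gamma c0 * Gamma_vec (map (\<lambda>x. 1 - x) ds) / (Gamma d0 * Gamma_vec (map (\<lambda>x. 1 - x) cs))"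

lemma not_nonpos_Ints:
  "c0 \<notin> \<int>\<^sub>\<le>\<^sub>0" "d0 \<notin> \<int>\<^sub>\<le>\<^sub>0" "1 - c0 \<notin> \<int>\<^sub>\<le>\<^sub>0" "1 - d0 \<notin> \<int>\<^sub>\<le>\<^sub>0"
  "\<forall>x\<in>set cs. x \<notin> \<int>\<^sub>\<le>\<^sub>0" "\<forall>x\<in>set ds. x \<notin> \<int>\<^sub>\<le>\<^sub>0"
  "\<forall>x\<in>set (map (\<lambda>x. 1 - x) cs). x \<notin> \<int>\<^sub>\<le>\<^sub>0" "\<forall>x\<in>set (map (\<lambda>x. 1 - x) ds). x \<notin> \<int>\<^sub>\<le>\<^sub>0"
  using nonint_shift[of _ 0] c0_nonint d0_nonint cs_nonint ds_nonint by auto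

lemma H0_neq_0: "H0 \<noteq> 0"
  unfolding H0_def using not_nonpos_Ints by (simp add: Gamma_vec_neq_0 Gamma_eq_zero_iff)

lemma V_of_nat: "V (of_nat n) = H0 * base_coeff n"
proof -
  have 1: "prod_list (map (\<lambda>x. rGamma (1 - x - of_nat n)) cs) = (-1) ^ (n * length cs) * poch_vec cs n / Gamma_vec (map (\<lambda>x. 1 - x) cs)"
    using prod_list_rGamma_minus_of_nat[of n "map (\<lambda>x. 1 - x) cs"] by (simp add: o_def)
  have 2: "prod_list (map (\<lambda>x. Gamma (1 - x - of_nat n)) ds) = (-1) ^ (n * length ds) * Gamma_vec (map (\<lambda>x. 1 - x) ds) / poch_vec ds n"
    using prod_list_Gamma_minus_of_nat[of n "map (\<lambda>x. 1 - x) ds"] by (simp add: o_def)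
  have 3: "rGamma (1 + of_nat m + of_nat n) = 1 / (of_nat (fact (m + n)) :: complex)"
    using Gamma_fact[of "m + n", where ?'a = complex] by (simp add: rGamma_inverse_Gamma divide_inverse add.assoc)
  have 4: "rGamma (1 + of_nat n) = 1 / (of_nat (fact n) :: complex)"
    using Gamma_fact[of n, where ?'a = complex] by (simp add: rGamma_inverse_Gamma divide_inverse)
  \<comment> \<open>The two lengths differ by 2, so the signs cancel.\<close>
  have sgn: "(-1) ^ (n * length cs) * (-1) ^ (n * length ds) = (1::complex)"
    unfolding power_add[symmetric] by (simp add: len algebra_simps)
  have "V (of_nat n) = ((-1) ^ (n * length cs) * (-1) ^ (n * length ds)) * (H0 * base_coeff n)"
    unfolding V_def H_def 1 2 3 4 H0_def base_coeff_def
    using not_nonpos_Ints by (simp add: Gamma_plus_of_nat rGamma_plus_of_nat rGamma_inverse_Gamma divide_inverse mult_ac)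
  then show ?thesis unfolding sgn by simp
qed

lemma H_neg: "H (- of_nat n) = H0 * (poch_vec (map (\<lambda>x. 1 - x) d) n / poch_vec (map (\<lambda>x. 1 - x) c) n)"
proof -
  have 1: "prod_list (map (\<lambda>x. rGamma (1 - x - - of_nat n)) cs) = 1 / (poch_vec (map (\<lambda>x. 1 - x) cs) n * Gamma_vec (map (\<lambda>x. 1 - x) cs))"
    using prod_list_rGamma_plus_of_nat[OF not_nonpos_Ints(7), of n] by (simp add: o_def)
  have 2: "prod_list (map (\<lambda>x. Gamma (1 - x - - of_nat n)) ds) = poch_vec (map (\<lambda>x. 1 - x) ds) n * Gamma_vec (map (\<lambda>x. 1 - x) ds)"
    using prod_list_Gamma_plus_of_nat[OF not_nonpos_Ints(8), of n] by (simp add: o_def)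
  have 3: "Gamma (c0 + - of_nat n) = (-1) ^ n * Gamma c0 / pochhammer (1 - c0) n"
    using Gamma_minus_of_nat[of c0 n] by simp
  have 4: "rGamma (d0 + - of_nat n) = (-1) ^ n * pochhammer (1 - d0) n * rGamma d0"
    using rGamma_minus_of_nat[of d0 n] by simp
  have sgn: "(-1) ^ n * (-1) ^ n = (1::complex)" by (simp flip: power_mult_distrib)
  have "H (- of_nat n) = ((-1) ^ n * (-1) ^ n) * (H0 * (poch_vec (map (\<lambda>x. 1 - x) d) n / poch_vec (map (\<lambda>x. 1 - x) c) n))"
    unfolding H_def 1 2 3 4 H0_def by (simp add: rGamma_inverse_Gamma divide_inverse mult_ac)
  then show ?thesis unfolding sgn by simp
qed

lemma sum_deriv_V_neg:
  "(\<Sum>k=1..m. deriv V (- of_nat k)) = H0 * (poch_vec (map (\<lambda>x. 1 - x) d) 1 / poch_vec (map (\<lambda>x. 1 - x) c) 1 *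
        (\<Sum>j<m. (-1) ^ j * poch_vec (map (\<lambda>x. 2 - x) d) j * of_nat (fact j)
                 / (poch_vec (map (\<lambda>x. 2 - x) c) j * of_nat (fact (m - 1 - j)))))"
proof -
  have "(\<Sum>k=1..m. deriv V (- of_nat k)) = (\<Sum>j<m. deriv V (- of_nat (Suc j)))"
    by (rule sum.reindex_cong[of Suc]) (auto simp: image_Suc_lessThan)
  also have "\<dots> = (\<Sum>j<m. H0 * (poch_vec (map (\<lambda>x. 1 - x) d) 1 / poch_vec (map (\<lambda>x. 1 - x) c) 1) *
        ((-1) ^ j * poch_vec (map (\<lambda>x. 2 - x) d) j * of_nat (fact j)
                 / (poch_vec (map (\<lambda>x. 2 - x) c) j * of_nat (fact (m - 1 - j)))))"
  proof (rule sum.cong[OF refl])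
    fix j assume j: "j \<in> {..<m}"
    then have "of_nat m - of_nat j = (1 + of_nat (m - 1 - j) :: complex)" by (simp add: of_nat_diff)
    then have r: "rGamma (of_nat m - of_nat j) = 1 / (of_nat (fact (m - 1 - j)) :: complex)"
      using Gamma_fact[of "m - 1 - j", where ?'a = complex] by (simp add: rGamma_inverse_Gamma divide_inverse)
    show "deriv V (- of_nat (Suc j)) = H0 * (poch_vec (map (\<lambda>x. 1 - x) d) 1 / poch_vec (map (\<lambda>x. 1 - x) c) 1) *
        ((-1) ^ j * poch_vec (map (\<lambda>x. 2 - x) d) j * of_nat (fact j)
                 / (poch_vec (map (\<lambda>x. 2 - x) c) j * of_nat (fact (m - 1 - j))))"
      unfolding deriv_V_neg H_neg r poch_vec_Suc by (simp add: divide_inverse mult_ac)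
  qed
  finally show ?thesis by (simp add: sum_distrib_left mult.assoc)
qed

text \<open>Reflecting psi(1 - x - n) to psi(x + n) + pi cot(pi x) completes the digamma bracket for
  all of \<open>c\<close> and \<open>d\<close>; the cotangents are independent of n by
  periodicity.\<close>

lemma deriv_V_of_nat:
  "deriv V (of_nat n) = H0 * (of_real pi * cot_sum * base_coeff n - base_coeff n *
     (sum_list (map (\<lambda>x. Digamma (x + of_nat n)) d) + Digamma (of_nat n + 1)
             + Digamma (1 + of_nat m + of_nat n) - sum_list (map (\<lambda>x. Digamma (x + of_nat n)) c)))"
proof -
  have refl: "Digamma (1 - x - of_nat n) = Digamma (x + of_nat n) + of_real pi * cot (of_real pi * x)"
    if "x \<notin> \<int>" for x :: complex
  proof -
    have "x + of_nat n \<notin> \<int>" using Ints_diff[of "x + of_nat n" "of_nat n"] that by auto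
    from Digamma_reflection[OF this] show ?thesis by (simp add: cot_pi_plus_of_nat diff_diff_eq)
  qed
  have L: "sum_list (map (\<lambda>x. Digamma (1 - x - of_nat n)) xs)
      = sum_list (map (\<lambda>x. Digamma (x + of_nat n)) xs) + of_real pi * sum_list (map (\<lambda>x. cot (of_real pi * x)) xs)"
    if "\<forall>x\<in>set xs. x \<notin> \<int>" for xs :: "complex list"
    using that
  proof (induction xs)
    case (Cons x xs)
    then show ?case using refl[of x] by (simp add: algebra_simps)
  qed simp
  show ?thesis
    unfolding deriv_V_nonneg V_of_nat \<Psi>_def L[OF cs_nonint] L[OF ds_nonint] cot_sum_def
    by (simp add: algebra_simps)
qed

lemma base_coeff_eq: "base_coeff n = (poch_vec c n / poch_vec ((1 + of_nat m) # d) n * 1 ^ n / of_nat (fact n)) / of_nat (fact m)"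
proof -
  have "of_nat (fact (m + n)) = of_nat (fact m) * pochhammer (1 + of_nat m :: complex) n"
    using pochhammer_product'[of "1::complex" m n] by (simp add: pochhammer_fact[symmetric] flip: pochhammer_fact)
  then show ?thesis unfolding base_coeff_def by (simp add: divide_inverse mult_ac)
qed

lemma base_coeff_sums: "base_coeff sums (hypF c ((1 + of_nat m) # d) 1 / of_nat (fact m))"
proof -
  note one_plus_of_nat_not_nonpos_Ints[of m]
  then have "summable (\<lambda>n. norm (poch_vec c n / poch_vec ((1 + of_nat m) # d) n * 1 ^ n / of_nat (fact n)))"
    using not_nonpos_Ints Re_excess len by (intro summable_norm_hyp_coeff) auto
  then have "(\<lambda>n. poch_vec c n / poch_vec ((1 + of_nat m) # d) n * 1 ^ n / of_nat (fact n)) sums hypF c ((1 + of_nat m) # d) 1"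
    unfolding hypF_def by (rule summable_sums[OF summable_norm_cancel])
  from sums_divide[OF this, of "of_nat (fact m)"] show ?thesis unfolding base_coeff_eq[abs_def] .
qed

text \<open>The residue at the first pole -c0; the residues at -c0 - n are multiples of it by the
  hypergeometric terms.\<close>

definition coeff_c :: complex where
  "coeff_c = rGamma (d0 - c0) * Gamma_vec (map (\<lambda>x. 1 - x + c0) ds) * rGamma (1 + of_nat m - c0) * rGamma (1 - c0)
     / (Gamma_vec (map (\<lambda>x. 1 - x + c0) cs) * sin (of_real pi * c0) ^ 2)"

lemma residue_c0_eq:
  "residue \<Phi> (- c0 - of_nat n) = coeff_c *
     (poch_vec (c0 # (c0 - of_nat m) # map (\<lambda>x. 1 - x + c0) d) n / poch_vec (map (\<lambda>x. 1 - x + c0) cs) n * 1 ^ n / of_nat (fact n))"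
proof -
  have ni: "1 - x + c0 \<notin> \<int>\<^sub>\<le>\<^sub>0" if "x - c0 \<notin> \<int>" for x
    using nonint_shift(2)[OF that, of 0] by (simp add: algebra_simps)
  have 1: "rGamma (d0 + (- c0 - of_nat n)) = (-1) ^ n * pochhammer (1 - d0 + c0) n * rGamma (d0 - c0)"
    using rGamma_minus_of_nat[of "d0 - c0" n] by (simp add: algebra_simps)
  have MrGamma: "map (\<lambda>x. rGamma (1 - x - (- c0 - of_nat n))) cs = map (\<lambda>x. rGamma (x + of_nat n)) (map (\<lambda>x. 1 - x + c0) cs)"
    by (simp add: algebra_simps)
  have 2: "prod_list (map (\<lambda>x. rGamma (1 - x - (- c0 - of_nat n))) cs)
      = 1 / (poch_vec (map (\<lambda>x. 1 - x + c0) cs) n * Gamma_vec (map (\<lambda>x. 1 - x + c0) cs))"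
    unfolding MrGamma by (rule prod_list_rGamma_plus_of_nat) (use ni cs_c0 in auto)
  have MGamma: "map (\<lambda>x. Gamma (1 - x - (- c0 - of_nat n))) ds = map (\<lambda>x. Gamma (x + of_nat n)) (map (\<lambda>x. 1 - x + c0) ds)"
    by (simp add: algebra_simps)
  have 3: "prod_list (map (\<lambda>x. Gamma (1 - x - (- c0 - of_nat n))) ds)
      = poch_vec (map (\<lambda>x. 1 - x + c0) ds) n * Gamma_vec (map (\<lambda>x. 1 - x + c0) ds)"
    unfolding MGamma by (rule prod_list_Gamma_plus_of_nat) (use ni ds_c0 in auto)
  have 4: "rGamma (1 + of_nat m + (- c0 - of_nat n)) = (-1) ^ n * pochhammer (c0 - of_nat m) n * rGamma (1 + of_nat m - c0)"
    using rGamma_minus_of_nat[of "1 + of_nat m - c0" n] by (simp add: algebra_simps)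
  have 5: "rGamma (1 + (- c0 - of_nat n)) = (-1) ^ n * pochhammer c0 n * rGamma (1 - c0)"
    using rGamma_minus_of_nat[of "1 - c0" n] by (simp add: algebra_simps)
  have 6: "sin (of_real pi * (- c0 - of_nat n)) ^ 2 = sin (of_real pi * c0) ^ 2"
    using sin_pi_minus_of_nat[of "- c0" n] by (simp add: power_mult_distrib flip: power_mult)
  have sgn: "(-1) ^ n * (-1) ^ n * (-1) ^ n * (-1) ^ n = (1::complex)" by (simp flip: power_mult_distrib)
  have "residue \<Phi> (- c0 - of_nat n) = ((-1) ^ n * (-1) ^ n * (-1) ^ n * (-1) ^ n) * (coeff_c *
     (poch_vec (c0 # (c0 - of_nat m) # map (\<lambda>x. 1 - x + c0) d) n / poch_vec (map (\<lambda>x. 1 - x + c0) cs) n * 1 ^ n / of_nat (fact n)))"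
    unfolding residue_c0 rest_c_def 1 2 3 4 5 6 coeff_c_def by (simp add: divide_inverse mult_ac)
  then show ?thesis unfolding sgn by simp
qed

text \<open>The series attached to c0, to each entry of \<open>ds\<close> and to the cotangent term
  all have the same excess sum d - sum c + m + 1, so \<open>Re_excess\<close> governs each of
  them.\<close>

lemma hyp_coeff_c_summable:
  "summable (\<lambda>n. norm (poch_vec (c0 # (c0 - of_nat m) # map (\<lambda>x. 1 - x + c0) d) n / poch_vec (map (\<lambda>x. 1 - x + c0) cs) n * 1 ^ n / of_nat (fact n)))"
proof (rule summable_norm_hyp_coeff)
  have ni: "1 - x + c0 \<notin> \<int>\<^sub>\<le>\<^sub>0" if "x - c0 \<notin> \<int>" for x
    using nonint_shift(2)[OF that, of 0] by (simp add: algebra_simps)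
  then show "\<forall>b\<in>set (map (\<lambda>x. 1 - x + c0) cs). b \<notin> \<int>\<^sub>\<le>\<^sub>0" using cs_c0 by auto
  have s: "sum_list (map (\<lambda>x. 1 - x + c0) xs) = of_nat (length xs) * (1 + c0) - sum_list xs" for xs
    by (induction xs) (auto simp: algebra_simps)
  have eq: "sum_list (map (\<lambda>x. 1 - x + c0) cs) - sum_list (c0 # (c0 - of_nat m) # map (\<lambda>x. 1 - x + c0) d)
     = d0 + sum_list ds - (c0 + sum_list cs) + of_nat m + 1"
    unfolding sum_list.Cons s by (simp add: len algebra_simps)
  show "Re (sum_list (map (\<lambda>x. 1 - x + c0) cs) - sum_list (c0 # (c0 - of_nat m) # map (\<lambda>x. 1 - x + c0) d)) > 0"
    unfolding eq using Re_excess by simp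
qed (simp add: len)

text \<open>Minus the residue at the first pole 1 - e: the variable enters Gamma(1 - e - s) with a
  negative sign.\<close>

definition coeff_d :: "nat \<Rightarrow> complex" where
  "coeff_d i = (let e = ds ! i in
     Gamma (1 + c0 - e) * rGamma (1 + d0 - e) * Gamma_vec (map (\<lambda>x. e - x) (drop_nth i ds))
     * rGamma (2 - e + of_nat m) * rGamma (2 - e) / (Gamma_vec (map (\<lambda>x. e - x) cs) * sin (of_real pi * e) ^ 2))"

abbreviation hyp_coeff_d :: "nat \<Rightarrow> nat \<Rightarrow> complex" where
  "hyp_coeff_d i n \<equiv> poch_vec (map (\<lambda>x. 1 + x - ds ! i) c) n
     / poch_vec ((2 - ds ! i) # (2 - ds ! i + of_nat m) # map (\<lambda>x. 1 + x - ds ! i) (d0 # drop_nth i ds)) n * 1 ^ n / of_nat (fact n)"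

lemma shifted_ds_not_nonpos_Ints:
  assumes i: "i < length ds"
  shows "1 + c0 - ds ! i \<notin> \<int>\<^sub>\<le>\<^sub>0" "1 + d0 - ds ! i \<notin> \<int>\<^sub>\<le>\<^sub>0" "2 - ds ! i \<notin> \<int>\<^sub>\<le>\<^sub>0" "2 - ds ! i + of_nat m \<notin> \<int>\<^sub>\<le>\<^sub>0"
    "\<forall>x\<in>set (drop_nth i ds). 1 + x - ds ! i \<notin> \<int>\<^sub>\<le>\<^sub>0"
proof -
  have di: "ds ! i \<in> set ds" using i by simp
  have *: "1 + x - ds ! i \<notin> \<int>\<^sub>\<le>\<^sub>0" if "ds ! i - x \<notin> \<int>" for x
    using nonint_shift(2)[OF that, of 0] by (simp add: algebra_simps)
  show "1 + c0 - ds ! i \<notin> \<int>\<^sub>\<le>\<^sub>0" "1 + d0 - ds ! i \<notin> \<int>\<^sub>\<le>\<^sub>0" using * ds_c0 ds_d0 di by blast+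
  show "2 - ds ! i \<notin> \<int>\<^sub>\<le>\<^sub>0" using nonint_shift(2)[of "ds ! i" "- 1"] ds_nonint di by simp
  show "2 - ds ! i + of_nat m \<notin> \<int>\<^sub>\<le>\<^sub>0"
    using nonint_shift(2)[of "ds ! i" "- 1 - int m"] ds_nonint di by (simp add: algebra_simps)
  show "\<forall>x\<in>set (drop_nth i ds). 1 + x - ds ! i \<notin> \<int>\<^sub>\<le>\<^sub>0"
  proof
    fix x assume "x \<in> set (drop_nth i ds)"
    then obtain j where "j < length ds" "j \<noteq> i" "x = ds ! j" by (rule in_set_drop_nthE)
    then show "1 + x - ds ! i \<notin> \<int>\<^sub>\<le>\<^sub>0" using *[of x] ds_ds[of i j] i by auto
  qed
qed

lemma length_drop_nth: "i < length xs \<Longrightarrow> length xs = Suc (length (drop_nth i xs))"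
  by (simp add: drop_nth_def min_def)

lemma residue_ds_eq:
  assumes i: "i < length ds"
  shows "residue \<Phi> (1 - ds ! i + of_nat n) = - coeff_d i * hyp_coeff_d i n"
proof -
  define e where "e = ds ! i"
  define dr where "dr = drop_nth i ds"
  note ni = shifted_ds_not_nonpos_Ints[OF i, folded e_def dr_def]
  have 1: "Gamma (c0 + (1 - e + of_nat n)) = pochhammer (1 + c0 - e) n * Gamma (1 + c0 - e)"
    using Gamma_plus_of_nat[OF ni(1), of n] by (simp add: algebra_simps)
  have 2: "rGamma (d0 + (1 - e + of_nat n)) = rGamma (1 + d0 - e) / pochhammer (1 + d0 - e) n"
    using rGamma_plus_of_nat[OF ni(2), of n] by (simp add: algebra_simps)
  have "map (\<lambda>x. rGamma (1 - x - (1 - e + of_nat n))) cs = map (\<lambda>z. rGamma (z - of_nat n)) (map (\<lambda>x. e - x) cs)"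
    by (simp add: algebra_simps)
  moreover have "map (\<lambda>z. 1 - z) (map (\<lambda>x. e - x) xs) = map (\<lambda>x. 1 + x - e) xs" for xs
    by simp
  ultimately have 3: "prod_list (map (\<lambda>x. rGamma (1 - x - (1 - e + of_nat n))) cs)
      = (-1) ^ (n * length cs) * poch_vec (map (\<lambda>x. 1 + x - e) cs) n / Gamma_vec (map (\<lambda>x. e - x) cs)"
    using prod_list_rGamma_minus_of_nat[of n "map (\<lambda>x. e - x) cs"] by (simp only: length_map)
  have "map (\<lambda>x. Gamma (1 - x - (1 - e + of_nat n))) dr = map (\<lambda>z. Gamma (z - of_nat n)) (map (\<lambda>x. e - x) dr)"
    by (simp add: algebra_simps)
  moreover have "map (\<lambda>z. 1 - z) (map (\<lambda>x. e - x) xs) = map (\<lambda>x. 1 + x - e) xs" for xs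
    by simp
  ultimately have 4: "prod_list (map (\<lambda>x. Gamma (1 - x - (1 - e + of_nat n))) dr)
      = (-1) ^ (n * length dr) * Gamma_vec (map (\<lambda>x. e - x) dr) / poch_vec (map (\<lambda>x. 1 + x - e) dr) n"
    using prod_list_Gamma_minus_of_nat[of n "map (\<lambda>x. e - x) dr"] by (simp only: length_map)
  have 5: "rGamma (1 + of_nat m + (1 - e + of_nat n)) = rGamma (2 - e + of_nat m) / pochhammer (2 - e + of_nat m) n"
    using rGamma_plus_of_nat[OF ni(4), of n] by (simp add: algebra_simps)
  have 6: "rGamma (1 + (1 - e + of_nat n)) = rGamma (2 - e) / pochhammer (2 - e) n"
    using rGamma_plus_of_nat[OF ni(3), of n] by (simp add: algebra_simps)
  have 7: "sin (of_real pi * (1 - e + of_nat n)) ^ 2 = sin (of_real pi * e) ^ 2"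
  proof -
    have eq: "1 - e + of_nat n = - e + of_nat (Suc n)" by simp
    show ?thesis unfolding eq sin_pi_plus_of_nat
      by (simp add: power_mult_distrib del: of_nat_Suc flip: power_mult)
  qed
  \<comment> \<open>Signs come from \<open>cs\<close>, from \<open>ds\<close> without its i-th entry
    and from the Gamma residue; the total exponent is even.\<close>
  have "n * length cs + n * length dr + n = 2 * (n * (length ds + 1))"
    using length_drop_nth[OF i, folded dr_def] len by (simp add: algebra_simps)
  then have sgn: "(-1) ^ (n * length cs) * (-1) ^ (n * length dr) * (-1) ^ n = (1::complex)"
    by (simp only: power_add[symmetric]) (simp only: power_mult, simp)
  have "residue \<Phi> (1 - e + of_nat n) = ((-1) ^ (n * length cs) * (-1) ^ (n * length dr) * (-1) ^ n) *
     (- coeff_d i * hyp_coeff_d i n)"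
    unfolding residue_ds[OF i, folded e_def] rest_d_def dr_def[symmetric] 1 2 3 4 5 6 7 coeff_d_def Let_def e_def[symmetric]
    by (simp add: divide_inverse mult_ac)
  then show ?thesis unfolding sgn e_def by simp
qed

lemma hyp_coeff_d_summable:
  assumes i: "i < length ds"
  shows "summable (\<lambda>n. norm (hyp_coeff_d i n))"
proof (rule summable_norm_hyp_coeff)
  let ?bs = "(2 - ds ! i) # (2 - ds ! i + of_nat m) # map (\<lambda>x. 1 + x - ds ! i) (d0 # drop_nth i ds)"
  show "\<forall>b\<in>set ?bs. b \<notin> \<int>\<^sub>\<le>\<^sub>0" using shifted_ds_not_nonpos_Ints[OF i] by auto
  note ld = length_drop_nth[OF i]
  then show "length (map (\<lambda>x. 1 + x - ds ! i) c) = length ?bs + 1" using len by simp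
  have s: "sum_list (map (\<lambda>x. 1 + x - ds ! i) xs) = of_nat (length xs) * (1 - ds ! i) + sum_list xs" for xs
    by (induction xs) (auto simp: algebra_simps)
  have "sum_list (take i ds @ ds ! i # drop (Suc i) ds) = ds ! i + sum_list (drop_nth i ds)"
    by (simp add: drop_nth_def)
  then have sd: "sum_list ds = ds ! i + sum_list (drop_nth i ds)"
    using id_take_nth_drop[OF i] by simp
  have eq: "sum_list ?bs - sum_list (map (\<lambda>x. 1 + x - ds ! i) c)
     = d0 + sum_list ds - (c0 + sum_list cs) + of_nat m + 1"
    unfolding s sum_list.Cons sd using len ld by (simp add: algebra_simps)
  show "Re (sum_list ?bs - sum_list (map (\<lambda>x. 1 + x - ds ! i) c)) > 0"
    unfolding eq using Re_excess by simp
qed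

text \<open>Both reciprocal Gammas carry a factor rGamma(1 - c0) = Gamma(c0) sin(pi c0)/pi, so
  together they cancel the squared sine and the factor pi^2.\<close>

lemma coeff_c_eq:
  "of_real pi ^ 2 * coeff_c = H0 * (Gamma c0 * Gamma d0 * Gamma_vec (map (\<lambda>x. 1 - x) cs)
        * Gamma_vec (map (\<lambda>x. 1 - x + c0) ds)
      / (pochhammer (1 - c0) m * Gamma (d0 - c0)
         * Gamma_vec (map (\<lambda>x. 1 - x + c0) cs) * Gamma_vec (map (\<lambda>x. 1 - x) ds)))"
proof -
  define s where "s = sin (of_real pi * c0)"
  define G where "G = Gamma_vec (map (\<lambda>x. 1 - x + c0) ds) / (Gamma (d0 - c0) * Gamma_vec (map (\<lambda>x. 1 - x + c0) cs))"
  have s: "s \<noteq> 0" unfolding s_def by (rule sin_pi_mult_nonzero[OF c0_nonint])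
  have 1: "rGamma (1 - c0) = Gamma c0 * (s / of_real pi)"
    unfolding s_def by (rule rGamma_one_minus[OF c0_nonint])
  have 2: "rGamma (1 + of_nat m - c0) = rGamma (1 - c0) / pochhammer (1 - c0) m"
    using rGamma_plus_of_nat[OF not_nonpos_Ints(3), of m] by (simp add: algebra_simps)
  have nz: "Gamma d0 \<noteq> 0" "Gamma_vec (map (\<lambda>x. 1 - x) cs) \<noteq> 0" "Gamma_vec (map (\<lambda>x. 1 - x) ds) \<noteq> 0"
    using not_nonpos_Ints by (simp_all add: Gamma_eq_zero_iff Gamma_vec_neq_0)
  have "of_real pi ^ 2 * coeff_c = Gamma c0 ^ 2 / pochhammer (1 - c0) m * G"
    unfolding coeff_c_def 2 1 s_def[symmetric] G_def using s
    by (simp add: rGamma_inverse_Gamma divide_inverse power2_eq_square mult_ac, simp add: field_simps)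
  also have "\<dots> = H0 * (Gamma c0 * Gamma d0 * Gamma_vec (map (\<lambda>x. 1 - x) cs)
        * Gamma_vec (map (\<lambda>x. 1 - x + c0) ds)
      / (pochhammer (1 - c0) m * Gamma (d0 - c0)
         * Gamma_vec (map (\<lambda>x. 1 - x + c0) cs) * Gamma_vec (map (\<lambda>x. 1 - x) ds)))"
    unfolding G_def H0_def using nz by (simp add: power2_eq_square)
  finally show ?thesis .
qed

text \<open>The prefactor of the last sum is exactly 1/\<open>H0\<close>, up to (-1)^m: the factors
  from \<open>cs\<close> and \<open>ds\<close> cancel, and the reflections at c0 and d0 each give
  pi.\<close>

lemma H0_reflect:
  "H0 * (Gamma_vec (map (\<lambda>x. 1 - x) c) * sin (of_real pi * c0)
      / (Gamma_vec (map (\<lambda>x. 1 - x) d) * sin (of_real pi * d0))) = 1"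
proof -
  have refl: "Gamma x * Gamma (1 - x) * sin (of_real pi * x) = of_real pi" if "x \<notin> \<int>" for x :: complex
    using Gamma_reflection_complex[of x] sin_pi_mult_nonzero[OF that] by (simp add: field_simps)
  have nz: "Gamma_vec (map (\<lambda>x. 1 - x) cs) \<noteq> 0" "Gamma_vec (map (\<lambda>x. 1 - x) ds) \<noteq> 0"
    using not_nonpos_Ints by (simp_all add: Gamma_vec_neq_0)
  have "H0 * (Gamma_vec (map (\<lambda>x. 1 - x) c) * sin (of_real pi * c0)
      / (Gamma_vec (map (\<lambda>x. 1 - x) d) * sin (of_real pi * d0)))
     = (Gamma c0 * Gamma (1 - c0) * sin (of_real pi * c0)) / (Gamma d0 * Gamma (1 - d0) * sin (of_real pi * d0))"
    unfolding H0_def using nz by (simp add: mult.assoc)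
  then show ?thesis unfolding refl[OF c0_nonint] refl[OF d0_nonint] by simp
qed

text \<open>Four reflections: the minus signs of the two \<open>rGamma_two_plus\<close> instances
  cancel, their sines cancel the squared sine, and those at e - d0 and e - c0 survive. Removing
  entry Suc i from \<open>d\<close> keeps d0, which supplies Gamma(e - d0).\<close>

lemma coeff_d_eq:
  assumes i: "i < length ds"
  shows "of_real pi ^ 2 * coeff_d i = (-1) ^ m * (Gamma (ds ! i - of_nat m) * Gamma (ds ! i)
           * Gamma_vec (map (\<lambda>x. ds ! i - x) (drop_nth (Suc i) d))
           * sin (of_real pi * (ds ! i - d0))
         / ((ds ! i - of_nat m - 1) * (ds ! i - 1) * Gamma_vec (map (\<lambda>x. ds ! i - x) c)
            * sin (of_real pi * (ds ! i - c0))))"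
proof -
  define e where "e = ds ! i"
  have e: "e \<in> set ds" using i by (simp add: e_def)
  then have ni: "e \<notin> \<int>" "e - c0 \<notin> \<int>" "e - d0 \<notin> \<int>"
    using ds_nonint ds_c0 ds_d0 by auto
  define s where "s = sin (of_real pi * e)"
  have s: "s \<noteq> 0" unfolding s_def by (rule sin_pi_mult_nonzero[OF ni(1)])
  have 1: "Gamma (1 + c0 - e) = rGamma (e - c0) * (of_real pi / sin (of_real pi * (e - c0)))"
    using Gamma_one_minus[OF ni(2)] by (simp add: algebra_simps)
  have 2: "rGamma (1 + d0 - e) = Gamma (e - d0) * (sin (of_real pi * (e - d0)) / of_real pi)"
    using rGamma_one_minus[OF ni(3)] by (simp add: algebra_simps)
  have 3: "rGamma (2 - e + of_nat m) = - ((-1) ^ m) * Gamma (e - of_nat m) / (e - of_nat m - 1) * (s / of_real pi)"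
    unfolding s_def by (rule rGamma_two_plus[OF ni(1)])
  have 4: "rGamma (2 - e) = - Gamma e / (e - 1) * (s / of_real pi)"
    unfolding s_def using rGamma_two_plus[OF ni(1), of 0] by simp
  have dn: "drop_nth (Suc i) d = d0 # drop_nth i ds" by (simp add: drop_nth_def)
  show ?thesis
    unfolding coeff_d_def Let_def e_def[symmetric] 1 2 3 4 s_def[symmetric] dn using s
    by (simp add: rGamma_inverse_Gamma divide_inverse power2_eq_square mult_ac, simp add: field_simps)
qed

text \<open>By \<open>deriv_V_of_nat\<close> the left-hand term is pi \<open>cot_sum\<close>
  \<open>base_coeff n\<close> minus V'(n)/\<open>H0\<close>. The first part sums to the cotangent
  term, the second is given by the residue identity.\<close>

theorem digamma_series_sums:
  "(\<lambda>k. poch_vec c k / (poch_vec d k * of_nat (fact (m + k)) * of_nat (fact k)) *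
            (sum_list (map (\<lambda>x. Digamma (x + of_nat k)) d) + Digamma (of_nat k + 1)
             + Digamma (1 + of_nat m + of_nat k) - sum_list (map (\<lambda>x. Digamma (x + of_nat k)) c)))
    sums
    ( complex_of_real pi / of_nat (fact m) *
        (sum_list (map (\<lambda>x. cot (complex_of_real pi * x)) cs)
         - sum_list (map (\<lambda>x. cot (complex_of_real pi * x)) ds))
        * hypF c ((1 + of_nat m) # d) 1
    + poch_vec (map (\<lambda>x. 1 - x) d) 1 / poch_vec (map (\<lambda>x. 1 - x) c) 1 *
        (\<Sum>j<m. (-1) ^ j * poch_vec (map (\<lambda>x. 2 - x) d) j * of_nat (fact j)
                 / (poch_vec (map (\<lambda>x. 2 - x) c) j * of_nat (fact (m - 1 - j))))
    + Gamma c0 * Gamma d0 * Gamma_vec (map (\<lambda>x. 1 - x) cs)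
        * Gamma_vec (map (\<lambda>x. 1 - x + c0) ds)
      / (pochhammer (1 - c0) m * Gamma (d0 - c0)
         * Gamma_vec (map (\<lambda>x. 1 - x + c0) cs) * Gamma_vec (map (\<lambda>x. 1 - x) ds))
      * hypF (c0 # (c0 - of_nat m) # map (\<lambda>x. 1 - x + c0) d)
             (map (\<lambda>x. 1 - x + c0) cs) 1
    - (-1) ^ m * Gamma_vec (map (\<lambda>x. 1 - x) c) * sin (complex_of_real pi * c0)
      / (Gamma_vec (map (\<lambda>x. 1 - x) d) * sin (complex_of_real pi * d0))
      * (\<Sum>i<length ds.
           Gamma (ds ! i - of_nat m) * Gamma (ds ! i)
           * Gamma_vec (map (\<lambda>x. ds ! i - x) (drop_nth (Suc i) d))
           * sin (complex_of_real pi * (ds ! i - d0))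
         / ((ds ! i - of_nat m - 1) * (ds ! i - 1) * Gamma_vec (map (\<lambda>x. ds ! i - x) c)
            * sin (complex_of_real pi * (ds ! i - c0)))
         * hypF (map (\<lambda>x. 1 + x - ds ! i) c)
                ((2 - ds ! i) # (2 - ds ! i + of_nat m) # map (\<lambda>x. 1 + x - ds ! i) (drop_nth (Suc i) d)) 1))"
proof -
  let ?L = "\<lambda>k. poch_vec c k / (poch_vec d k * of_nat (fact (m + k)) * of_nat (fact k)) *
            (sum_list (map (\<lambda>x. Digamma (x + of_nat k)) d) + Digamma (of_nat k + 1)
             + Digamma (1 + of_nat m + of_nat k) - sum_list (map (\<lambda>x. Digamma (x + of_nat k)) c))"
  let ?F1 = "hypF c ((1 + of_nat m) # d) 1"
  let ?T2 = "poch_vec (map (\<lambda>x. 1 - x) d) 1 / poch_vec (map (\<lambda>x. 1 - x) c) 1 *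
        (\<Sum>j<m. (-1) ^ j * poch_vec (map (\<lambda>x. 2 - x) d) j * of_nat (fact j)
                 / (poch_vec (map (\<lambda>x. 2 - x) c) j * of_nat (fact (m - 1 - j))))"
  let ?K3 = "Gamma c0 * Gamma d0 * Gamma_vec (map (\<lambda>x. 1 - x) cs)
        * Gamma_vec (map (\<lambda>x. 1 - x + c0) ds)
      / (pochhammer (1 - c0) m * Gamma (d0 - c0)
         * Gamma_vec (map (\<lambda>x. 1 - x + c0) cs) * Gamma_vec (map (\<lambda>x. 1 - x) ds))"
  let ?F3 = "hypF (c0 # (c0 - of_nat m) # map (\<lambda>x. 1 - x + c0) d) (map (\<lambda>x. 1 - x + c0) cs) 1"
  let ?Q = "Gamma_vec (map (\<lambda>x. 1 - x) c) * sin (complex_of_real pi * c0)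
      / (Gamma_vec (map (\<lambda>x. 1 - x) d) * sin (complex_of_real pi * d0))"
  let ?K4 = "\<lambda>i. Gamma (ds ! i - of_nat m) * Gamma (ds ! i)
           * Gamma_vec (map (\<lambda>x. ds ! i - x) (drop_nth (Suc i) d))
           * sin (complex_of_real pi * (ds ! i - d0))
         / ((ds ! i - of_nat m - 1) * (ds ! i - 1) * Gamma_vec (map (\<lambda>x. ds ! i - x) c)
            * sin (complex_of_real pi * (ds ! i - c0)))"
  let ?F4 = "\<lambda>i. hypF (map (\<lambda>x. 1 + x - ds ! i) c)
                ((2 - ds ! i) # (2 - ds ! i + of_nat m) # map (\<lambda>x. 1 + x - ds ! i) (drop_nth (Suc i) d)) 1"
  have dn: "drop_nth (Suc i) d = d0 # drop_nth i ds" for i by (simp add: drop_nth_def)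
  have Sc: "(\<Sum>n. residue \<Phi> (- c0 - of_nat n)) = coeff_c * ?F3"
    unfolding residue_c0_eq hypF_def by (rule suminf_mult[OF summable_norm_cancel[OF hyp_coeff_c_summable]])
  have Sd: "(\<Sum>n. residue \<Phi> (1 - ds ! i + of_nat n)) = - coeff_d i * ?F4 i" if "i < length ds" for i
    unfolding residue_ds_eq[OF that] hypF_def dn
    by (rule suminf_mult[OF summable_norm_cancel[OF hyp_coeff_d_summable[OF that]]])
  have D: "(\<lambda>n. deriv V (of_nat n)) sums
     (- (\<Sum>k=1..m. deriv V (- of_nat k)) - of_real pi ^ 2 * ((\<Sum>n. residue \<Phi> (- c0 - of_nat n))
         + (\<Sum>i<length ds. \<Sum>n. residue \<Phi> (1 - ds ! i + of_nat n))))"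
  proof (rule deriv_V_sums)
    show "summable (\<lambda>n. norm (residue \<Phi> (- c0 - of_nat n)))"
      unfolding residue_c0_eq norm_mult[of coeff_c] by (intro summable_mult hyp_coeff_c_summable)
    show "summable (\<lambda>n. norm (residue \<Phi> (1 - ds ! i + of_nat n)))" if "i < length ds" for i
      unfolding residue_ds_eq[OF that] norm_mult[of "- coeff_d i"]
      by (intro summable_mult hyp_coeff_d_summable[OF that])
  qed
  have "- (\<Sum>k=1..m. deriv V (- of_nat k)) - of_real pi ^ 2 * ((\<Sum>n. residue \<Phi> (- c0 - of_nat n))
         + (\<Sum>i<length ds. \<Sum>n. residue \<Phi> (1 - ds ! i + of_nat n)))
      = - (H0 * ?T2) - ((of_real pi ^ 2 * coeff_c) * ?F3 - (\<Sum>i<length ds. (of_real pi ^ 2 * coeff_d i) * ?F4 i))"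
  proof -
    have S1: "(\<Sum>i<length ds. \<Sum>n. residue \<Phi> (1 - ds ! i + of_nat n)) = - (\<Sum>i<length ds. coeff_d i * ?F4 i)"
      unfolding sum_negf[symmetric] by (rule sum.cong) (simp_all only: Sd lessThan_iff mult_minus_left)
    have S2: "(\<Sum>i<length ds. (of_real pi ^ 2 * coeff_d i) * ?F4 i) = of_real pi ^ 2 * (\<Sum>i<length ds. coeff_d i * ?F4 i)"
      by (simp only: sum_distrib_left mult.assoc)
    have gen: "- T - P * (C * F + - S) = - T - ((P * C) * F - P * S)" for T P C F S :: complex
      by (simp add: algebra_simps)
    show ?thesis unfolding sum_deriv_V_neg Sc S1 S2 by (rule gen)
  qed
  also have "of_real pi ^ 2 * coeff_c = H0 * ?K3" by (rule coeff_c_eq)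
  also have "(\<Sum>i<length ds. (of_real pi ^ 2 * coeff_d i) * ?F4 i)
      = (H0 * ?Q) * (\<Sum>i<length ds. (-1) ^ m * ?K4 i * ?F4 i)"
    unfolding H0_reflect mult_1 by (rule sum.cong) (simp_all only: coeff_d_eq lessThan_iff)
  finally have lim: "- (\<Sum>k=1..m. deriv V (- of_nat k)) - of_real pi ^ 2 * ((\<Sum>n. residue \<Phi> (- c0 - of_nat n))
         + (\<Sum>i<length ds. \<Sum>n. residue \<Phi> (1 - ds ! i + of_nat n)))
      = - (H0 * ?T2) - ((H0 * ?K3) * ?F3 - (H0 * ?Q) * (\<Sum>i<length ds. (-1) ^ m * ?K4 i * ?F4 i))" .
  have "(\<lambda>n. of_real pi * cot_sum * base_coeff n - deriv V (of_nat n) / H0) sums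
     (of_real pi * cot_sum * (?F1 / of_nat (fact m))
      - (- (H0 * ?T2) - ((H0 * ?K3) * ?F3 - (H0 * ?Q) * (\<Sum>i<length ds. (-1) ^ m * ?K4 i * ?F4 i))) / H0)"
    by (intro sums_diff sums_mult sums_divide base_coeff_sums D[unfolded lim])
  also have "(\<lambda>n. of_real pi * cot_sum * base_coeff n - deriv V (of_nat n) / H0) = ?L"
    unfolding deriv_V_of_nat base_coeff_def using H0_neq_0 by (intro ext) simp
  also have "of_real pi * cot_sum * (?F1 / of_nat (fact m))
      - (- (H0 * ?T2) - ((H0 * ?K3) * ?F3 - (H0 * ?Q) * (\<Sum>i<length ds. (-1) ^ m * ?K4 i * ?F4 i))) / H0
    = of_real pi / of_nat (fact m) * cot_sum * ?F1 + ?T2 + ?K3 * ?F3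
       - (-1) ^ m * ?Q * (\<Sum>i<length ds. ?K4 i * ?F4 i)"
  proof -
    have S: "(\<Sum>i<length ds. (-1) ^ m * ?K4 i * ?F4 i) = (-1) ^ m * (\<Sum>i<length ds. ?K4 i * ?F4 i)"
      by (simp only: sum_distrib_left mult.assoc)
    have gen: "A * B * (F / M) - (- (h * T) - ((h * K) * F' - (h * Q) * (e * S))) / h
        = A / M * B * F + T + K * F' - e * Q * S" if "h \<noteq> 0" for A B F M h T K F' Q e S :: complex
      using that by (simp add: diff_divide_distrib add_divide_distrib)
    show ?thesis unfolding S by (rule gen[OF H0_neq_0])
  qed
  finally show ?thesis unfolding cot_sum_def by (simp only: times_divide_eq_right mult.assoc)
qed

end

text \<open>\<open>sums\<close> claims convergence as well as the value. Positions in lists start at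
  0, so c_1 is \<open>c ! 0\<close> and the range k = 2, ..., p - 1 becomes
  \<open>{1..<p - 1}\<close>.\<close>

theorem mainTheorem2:
  fixes p m :: nat and c d :: "complex list"
  assumes hp: "p \<ge> 2"
    and hc: "length c = p + 1" and hd: "length d = p - 1"
    and cZ: "\<forall>x\<in>set c. x \<notin> \<int>"
    and dZ: "\<forall>x\<in>set d. x \<notin> \<int>"
    and hRe: "Re (sum_list d - sum_list c) > - real m - 1"
    and gc: "\<forall>i<length c. \<forall>j<length c. i \<noteq> j \<longrightarrow> c ! i - c ! j \<notin> \<int>"
    and gd: "\<forall>i<length d. \<forall>j<length d. i \<noteq> j \<longrightarrow> d ! i - d ! j \<notin> \<int>"
    and gdc: "\<forall>j<length d. d ! j - c ! 0 \<notin> \<int>"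
  shows "(\<lambda>k. poch_vec c k / (poch_vec d k * of_nat (fact (m + k)) * of_nat (fact k)) *
            (sum_list (map (\<lambda>x. Digamma (x + of_nat k)) d) + Digamma (of_nat k + 1)
             + Digamma (1 + of_nat m + of_nat k) - sum_list (map (\<lambda>x. Digamma (x + of_nat k)) c)))
    sums
    ( complex_of_real pi / of_nat (fact m) *
        (sum_list (map (\<lambda>x. cot (complex_of_real pi * x)) (tl c))
         - sum_list (map (\<lambda>x. cot (complex_of_real pi * x)) (tl d)))
        * hypF c ((1 + of_nat m) # d) 1
    + poch_vec (map (\<lambda>x. 1 - x) d) 1 / poch_vec (map (\<lambda>x. 1 - x) c) 1 *
        (\<Sum>j<m. (-1) ^ j * poch_vec (map (\<lambda>x. 2 - x) d) j * of_nat (fact j)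
                 / (poch_vec (map (\<lambda>x. 2 - x) c) j * of_nat (fact (m - 1 - j))))
    + Gamma (c ! 0) * Gamma (d ! 0) * Gamma_vec (map (\<lambda>x. 1 - x) (tl c))
        * Gamma_vec (map (\<lambda>x. 1 - x + c ! 0) (tl d))
      / (pochhammer (1 - c ! 0) m * Gamma (d ! 0 - c ! 0)
         * Gamma_vec (map (\<lambda>x. 1 - x + c ! 0) (tl c)) * Gamma_vec (map (\<lambda>x. 1 - x) (tl d)))
      * hypF (c ! 0 # (c ! 0 - of_nat m) # map (\<lambda>x. 1 - x + c ! 0) d)
             (map (\<lambda>x. 1 - x + c ! 0) (tl c)) 1
    - (-1) ^ m * Gamma_vec (map (\<lambda>x. 1 - x) c) * sin (complex_of_real pi * c ! 0)
      / (Gamma_vec (map (\<lambda>x. 1 - x) d) * sin (complex_of_real pi * d ! 0))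
      * (\<Sum>i\<in>{1..<p - 1}.
           Gamma (d ! i - of_nat m) * Gamma (d ! i)
           * Gamma_vec (map (\<lambda>x. d ! i - x) (drop_nth i d))
           * sin (complex_of_real pi * (d ! i - d ! 0))
         / ((d ! i - of_nat m - 1) * (d ! i - 1) * Gamma_vec (map (\<lambda>x. d ! i - x) c)
            * sin (complex_of_real pi * (d ! i - c ! 0)))
         * hypF (map (\<lambda>x. 1 + x - d ! i) c)
                ((2 - d ! i) # (2 - d ! i + of_nat m) # map (\<lambda>x. 1 + x - d ! i) (drop_nth i d)) 1))"
proof -
  obtain c0 cs where c: "c = c0 # cs" using hc by (cases c) auto
  obtain d0 ds where d: "d = d0 # ds" using hd hp by (cases d) auto
  have lens: "length cs = p" "p - 1 = Suc (length ds)" using hc hd hp by (auto simp: c d)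
  interpret barnes_integrand m c0 d0 cs ds
  proof
    show "length cs = length ds + 2" using lens hp by simp
    show "\<forall>x\<in>set cs. x - c0 \<notin> \<int>"
    proof
      fix x assume "x \<in> set cs"
      then obtain j where "j < length cs" "x = cs ! j" by (auto simp: in_set_conv_nth)
      then show "x - c0 \<notin> \<int>" using gc[rule_format, of "Suc j" 0] by (simp add: c)
    qed
    show "\<forall>x\<in>set ds. x - c0 \<notin> \<int>"
    proof
      fix x assume "x \<in> set ds"
      then obtain j where "j < length ds" "x = ds ! j" by (auto simp: in_set_conv_nth)
      then show "x - c0 \<notin> \<int>" using gdc[rule_format, of "Suc j"] by (simp add: c d)
    qed
    show "\<forall>x\<in>set ds. x - d0 \<notin> \<int>"
    proof
      fix x assume "x \<in> set ds"
      then obtain j where "j < length ds" "x = ds ! j" by (auto simp: in_set_conv_nth)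
      then show "x - d0 \<notin> \<int>" using gd[rule_format, of "Suc j" 0] by (simp add: d)
    qed
    show "ds ! i - ds ! j \<notin> \<int>" if "i < length ds" "j < length ds" "i \<noteq> j" for i j
      using gd[rule_format, of "Suc i" "Suc j"] that by (simp add: d)
    show "d0 - c0 \<notin> \<int>" using gdc[rule_format, of 0] by (simp add: c d)
  qed (use cZ dZ hRe in \<open>auto simp: c d\<close>)
  have reindex: "(\<Sum>i\<in>{1..<p - 1}. f i) = (\<Sum>i<length ds. f (Suc i))" for f :: "nat \<Rightarrow> complex"
    unfolding lens(2) by (rule sum.reindex_cong[of Suc]) (auto simp: image_Suc_lessThan)
  show ?thesis
    unfolding reindex unfolding c d nth_Cons_0 nth_Cons_Suc list.sel(3)
    by (rule digamma_series_sums)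
qed

end
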